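(* From each one of the deformed equations ${\rm H1}^\sigma_\epsilon$, ${\rm H2}^\sigma_\epsilon$, ${\rm H3}^\sigma_\epsilon$, $\sigma=\pm1$, $$\mathcal{E}(u_{n,m},u_{n+1,m},u_{n,m+1},u_{n+1,m+1};n,m;\alpha,\beta;\sigma)=0,$$ two different discrete Toda type equations for $u$ can be derived (by means of two different three-leg forms of the equation). The resulting Toda systems can be written in the compact form $$\mathcal{H}_{n,m}(u_{n,m},u_{n+2,m},u_{n+1,m+1})-\mathcal{H}_{n,m}(u_{n,m+2},u_{n+2,m+2},u_{n+1,m+1})=0$$ (an equation which remains invariant under the interchange of $u_{n+2,m}$ and $u_{n,m+2}$), where: - for ${\rm H1}^\sigma_\epsilon$, $$\mathcal{H}_{n,m}(x,y,z)=\frac{x-y}{(x-z)(y-z)-\epsilon\,\mathcal{X}_{n,m}(\alpha-\beta)^2};$$ - for ${\rm H2}^\sigma_\epsilon$, $$\mathcal{H}_{n,m}(x,y,z)=\frac{x-y}{(x-z+a_{n,m})(y-z+b_{n,m})-8\epsilon\,\mathcal{X}_{n,m}(\alpha-\beta)^2\big(z+\alpha(1-2\epsilon\alpha)\big)},$$ with $a_{n,m}=(\beta-\alpha)\big(1-2\epsilon\mathcal{X}_{n,m}(\alpha+\beta)\big)$ and $b_{n,m}=(\alpha-\beta)\big(1-2\epsilon\mathcal{X}_{n,m}(3\alpha-\beta)\big)$; - for ${\rm H3}^\sigma_\epsilon$, $$\mathcal{H}_{n,m}(x,y,z)=\frac{x-y}{\alpha\beta(\alpha x-\beta z)(\beta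 y-\alpha z)-\delta\epsilon\,\mathcal{X}_{n,m}(\alpha^2-\beta^2)^2}.$$ The two different Toda type equations are those given by the two values $\mathcal{X}_{n,m}=0$ and $\mathcal{X}_{n,m}=1$.
   Context: The unknown $u$ is a function $\mathbb{Z}\times\mathbb{Z}\to\mathbb{C}$, with $u_{n,m}=u(n,m)$; $\alpha,\beta$ are the lattice parameters, $\epsilon,\delta$ are constants, and $\sigma=\pm1$. Put $$\mathcal{X}_{n,m}=\frac{1+\sigma(-1)^{n+m}}{2},\qquad \mathcal{Y}_{n,m}=\frac{1-\sigma(-1)^{n+m}}{2}.$$ The polynomial $\mathcal{E}(x_1,x_2,x_3,x_4;n,m;\alpha,\beta;\sigma)$, affine linear in each $x_i$, is one of: - ${\rm H1}^\sigma_\epsilon$: $(x_1-x_4)(x_2-x_3)-(\alpha-\beta)+\epsilon(\alpha-\beta)\{\mathcal{X}_{n,m}x_2x_3+\mathcal{Y}_{n,m}x_1x_4\}$; - ${\rm H2}^\sigma_\epsilon$: $(x_1-x_4)(x_2-x_3)+(\beta-\alpha)(x_1+x_2+x_3+x_4)-\alpha^2+\beta^2-\epsilon(\beta-\alpha)^3-\epsilon(\beta-\alpha)\{2\mathcal{Y}_{n,m}x_1+2\mathcal{X}_{n,m}x_2+\alpha+\beta\}\{2\mathcal{Y}_{n,m}x_4+2\mathcal{X}_{n,m}x_3+\alpha+\beta\}$; - ${\rm H3}^\sigma_\epsilon$: $\alpha(x_1x_2+x_3x_4)-\beta(x_1x_3+x_2x_4)+(\alpha^2-\beta^2)\delta-\frac{\epsilon(\alpha^2-\beta^2)}{\alpha\beta}\{\mathcal{X}_{n,m}x_2x_3+\mathcal{Y}_{n,m}x_1x_4\}$.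 A three-leg form of such an equation is a rewriting of it, on an elementary quadrilateral with a distinguished vertex, as $F(w_1,w_2,\alpha)/F(w_1,w_3,\beta)=W(w_1,w_4)$ (or additively, $F(w_1,w_2,\alpha)-F(w_1,w_3,\beta)=W(w_1,w_4)$), where $w_1$ is the value of $u$ at the distinguished vertex, $w_2,w_3$ are the values at the vertices joined to it by the edges carrying $\alpha$ and $\beta$ respectively, and $w_4$ is the value at the diagonally opposite vertex. Vertices $(n,m)$ with $\mathcal{X}_{n,m}=1$ are called black and those with $\mathcal{X}_{n,m}=0$ white; the two three-leg forms correspond to the diagonal joining two black, respectively two white, vertices.
   Formalization: Toda equations are derived for solutions nonsingular on the four edges at the centre, with nonzero denominators and α≠β (H3: αβ≠0, α²≠β²); the two equations are shown different only for ε≠0 and, for H3, δ≠0, since otherwise they coincide. *)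

theory Defs
  imports Complex_Main
begin

datatype eqn = H1 | H2 | H3

definition chiX :: "complex \<Rightarrow> int \<Rightarrow> int \<Rightarrow> complex" where
  "chiX \<sigma> n m = (1 + \<sigma> * (-1) powi (n + m)) / 2"

definition chiY :: "complex \<Rightarrow> int \<Rightarrow> int \<Rightarrow> complex" where
  "chiY \<sigma> n m = (1 - \<sigma> * (-1) powi (n + m)) / 2"

text \<open>The equation on the quadrilateral with lower left vertex (n,m).  The constant
  \<delta> occurs only in H3.\<close>

fun quad_poly :: "eqn \<Rightarrow> complex \<Rightarrow> complex \<Rightarrow> complex \<Rightarrow> complex \<Rightarrow> complex \<Rightarrow> int \<Rightarrow> int
    \<Rightarrow> complex \<Rightarrow> complex \<Rightarrow> complex \<Rightarrow> complex \<Rightarrow> complex" where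
  "quad_poly H1 \<epsilon> \<delta> \<sigma> \<alpha> \<beta> n m x1 x2 x3 x4 =
     (x1 - x4) * (x2 - x3) - (\<alpha> - \<beta>)
     + \<epsilon> * (\<alpha> - \<beta>) * (chiX \<sigma> n m * x2 * x3 + chiY \<sigma> n m * x1 * x4)"
| "quad_poly H2 \<epsilon> \<delta> \<sigma> \<alpha> \<beta> n m x1 x2 x3 x4 =
     (x1 - x4) * (x2 - x3) + (\<beta> - \<alpha>) * (x1 + x2 + x3 + x4) - \<alpha>^2 + \<beta>^2
     - \<epsilon> * (\<beta> - \<alpha>)^3
     - \<epsilon> * (\<beta> - \<alpha>) * (2 * chiY \<sigma> n m * x1 + 2 * chiX \<sigma> n m * x2 + \<alpha> + \<beta>)
                     * (2 * chiY \<sigma> n m * x4 + 2 * chiX \<sigma> n m * x3 + \<alpha> + \<beta>)"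
| "quad_poly H3 \<epsilon> \<delta> \<sigma> \<alpha> \<beta> n m x1 x2 x3 x4 =
     \<alpha> * (x1 * x2 + x3 * x4) - \<beta> * (x1 * x3 + x2 * x4) + (\<alpha>^2 - \<beta>^2) * \<delta>
     - \<epsilon> * (\<alpha>^2 - \<beta>^2) / (\<alpha> * \<beta>) * (chiX \<sigma> n m * x2 * x3 + chiY \<sigma> n m * x1 * x4)"

text \<open>Lattice parameters for which the equation makes sense and is not degenerate
  (each polynomial factorises or loses its parameter terms for \<alpha> = \<beta>, and the one of H3
  also for \<alpha> = - \<beta>).\<close>

fun generic_params :: "eqn \<Rightarrow> complex \<Rightarrow> complex \<Rightarrow> bool" where
  "generic_params H1 \<alpha> \<beta> \<longleftrightarrow> \<alpha> \<noteq> \<beta>"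
| "generic_params H2 \<alpha> \<beta> \<longleftrightarrow> \<alpha> \<noteq> \<beta>"
| "generic_params H3 \<alpha> \<beta> \<longleftrightarrow> \<alpha> \<noteq> 0 \<and> \<beta> \<noteq> 0 \<and> \<alpha>^2 \<noteq> \<beta>^2"

definition solution ::
  "eqn \<Rightarrow> complex \<Rightarrow> complex \<Rightarrow> complex \<Rightarrow> complex \<Rightarrow> complex \<Rightarrow> (int \<Rightarrow> int \<Rightarrow> complex) \<Rightarrow> bool" where
  "solution T \<epsilon> \<delta> \<sigma> \<alpha> \<beta> u \<longleftrightarrow>
     (\<forall>n m. quad_poly T \<epsilon> \<delta> \<sigma> \<alpha> \<beta> n m (u n m) (u (n+1) m) (u n (m+1)) (u (n+1) (m+1)) = 0)"

text \<open>The four quadrilaterals with distinguished vertex (n,m): it is joined to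
  (step r n, m) by an \<alpha>-edge and to (n, step t m) by a \<beta>-edge, and (step r n, step t m)
  is the opposite vertex.  The values at these vertices are w1, w2, w3, w4 in this order.\<close>

definition step :: "bool \<Rightarrow> int \<Rightarrow> int" where
  "step r n = (if r then n + 1 else n - 1)"

fun corner_poly :: "eqn \<Rightarrow> complex \<Rightarrow> complex \<Rightarrow> complex \<Rightarrow> complex \<Rightarrow> complex \<Rightarrow> int \<Rightarrow> int
    \<Rightarrow> bool \<Rightarrow> bool \<Rightarrow> complex \<Rightarrow> complex \<Rightarrow> complex \<Rightarrow> complex \<Rightarrow> complex" where
  "corner_poly T \<epsilon> \<delta> \<sigma> \<alpha> \<beta> n m True True w1 w2 w3 w4 =
     quad_poly T \<epsilon> \<delta> \<sigma> \<alpha> \<beta> n m w1 w2 w3 w4"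
| "corner_poly T \<epsilon> \<delta> \<sigma> \<alpha> \<beta> n m False True w1 w2 w3 w4 =
     quad_poly T \<epsilon> \<delta> \<sigma> \<alpha> \<beta> (n-1) m w2 w1 w4 w3"
| "corner_poly T \<epsilon> \<delta> \<sigma> \<alpha> \<beta> n m True False w1 w2 w3 w4 =
     quad_poly T \<epsilon> \<delta> \<sigma> \<alpha> \<beta> n (m-1) w3 w4 w1 w2"
| "corner_poly T \<epsilon> \<delta> \<sigma> \<alpha> \<beta> n m False False w1 w2 w3 w4 =
     quad_poly T \<epsilon> \<delta> \<sigma> \<alpha> \<beta> (n-1) (m-1) w4 w3 w2 w1"

text \<open>The biquadratic polynomial Q_s Q_t - Q Q_st of a polynomial Q affine linear in s
  and t; it does not depend on s and t, and this is its value.  A solution is singular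
  on an edge (diagonal) if the biquadratic of the two values there, obtained by eliminating
  the two other values, vanishes.\<close>

definition biquadratic :: "(complex \<Rightarrow> complex \<Rightarrow> complex) \<Rightarrow> complex" where
  "biquadratic Q = Q 1 0 * Q 0 1 - Q 0 0 * Q 1 1"

definition legs_nonsingular ::
  "(complex \<Rightarrow> complex \<Rightarrow> complex \<Rightarrow> complex \<Rightarrow> complex) \<Rightarrow> complex \<Rightarrow> complex \<Rightarrow> complex \<Rightarrow> bool" where
  "legs_nonsingular Q w1 w2 w3 \<longleftrightarrow>
     biquadratic (\<lambda>s t. Q w1 w2 s t) \<noteq> 0 \<and> biquadratic (\<lambda>s t. Q w1 s w3 t) \<noteq> 0"

definition diagonal_nonsingular ::
  "(complex \<Rightarrow> complex \<Rightarrow> complex \<Rightarrow> complex \<Rightarrow> complex) \<Rightarrow> complex \<Rightarrow> complex \<Rightarrow> bool" where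
  "diagonal_nonsingular Q w1 w4 \<longleftrightarrow> biquadratic (\<lambda>s t. Q w1 s t w4) \<noteq> 0"

text \<open>(F, W) is a three-leg form for the quadrilaterals whose distinguished vertex has
  colour c (1 is black, 0 is white).  The form is multiplicative where mult w1 holds and
  additive elsewhere: a multiplicative form with F and W Moebius in their second argument
  degenerates to an additive one at the special values of w1 at which its zero and
  its pole merge, and only finitely many exceptional values are allowed.  The leg F depends only on the
  parameter of its own edge.  Off the singular edges and diagonals the form has to be
  well defined and equivalent to the equation.\<close>

definition three_leg_form ::
  "eqn \<Rightarrow> complex \<Rightarrow> complex \<Rightarrow> complex \<Rightarrow> complex \<Rightarrow> (complex \<Rightarrow> bool)
    \<Rightarrow> (complex \<Rightarrow> complex \<Rightarrow> complex \<Rightarrow> complex)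
    \<Rightarrow> (complex \<Rightarrow> complex \<Rightarrow> complex \<Rightarrow> complex \<Rightarrow> complex) \<Rightarrow> bool" where
  "three_leg_form T \<epsilon> \<delta> \<sigma> c mult F W \<longleftrightarrow>
     (finite {w. mult w} \<or> finite {w. \<not> mult w}) \<and>
     (\<forall>\<alpha> \<beta> n m r t w1 w2 w3 w4.
        generic_params T \<alpha> \<beta> \<longrightarrow> chiX \<sigma> n m = c \<longrightarrow>
        legs_nonsingular (corner_poly T \<epsilon> \<delta> \<sigma> \<alpha> \<beta> n m r t) w1 w2 w3 \<longrightarrow>
        diagonal_nonsingular (corner_poly T \<epsilon> \<delta> \<sigma> \<alpha> \<beta> n m r t) w1 w4 \<longrightarrow>
        (if mult w1
         then F w1 w2 \<alpha> \<noteq> 0 \<and> F w1 w3 \<beta> \<noteq> 0 \<and> W \<alpha> \<beta> w1 w4 \<noteq> 0 \<and>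
              (corner_poly T \<epsilon> \<delta> \<sigma> \<alpha> \<beta> n m r t w1 w2 w3 w4 = 0
                 \<longleftrightarrow> F w1 w2 \<alpha> / F w1 w3 \<beta> = W \<alpha> \<beta> w1 w4)
         else (corner_poly T \<epsilon> \<delta> \<sigma> \<alpha> \<beta> n m r t w1 w2 w3 w4 = 0
                 \<longleftrightarrow> F w1 w2 \<alpha> - F w1 w3 \<beta> = W \<alpha> \<beta> w1 w4)))"

definition star_legs_nonsingular ::
  "eqn \<Rightarrow> complex \<Rightarrow> complex \<Rightarrow> complex \<Rightarrow> complex \<Rightarrow> complex \<Rightarrow> (int \<Rightarrow> int \<Rightarrow> complex)
    \<Rightarrow> int \<Rightarrow> int \<Rightarrow> bool" where
  "star_legs_nonsingular T \<epsilon> \<delta> \<sigma> \<alpha> \<beta> u n m \<longleftrightarrow>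
     (\<forall>r t. legs_nonsingular (corner_poly T \<epsilon> \<delta> \<sigma> \<alpha> \<beta> n m r t)
              (u n m) (u (step r n) m) (u n (step t m)))"

definition star_diagonals_nonsingular ::
  "eqn \<Rightarrow> complex \<Rightarrow> complex \<Rightarrow> complex \<Rightarrow> complex \<Rightarrow> complex \<Rightarrow> (int \<Rightarrow> int \<Rightarrow> complex)
    \<Rightarrow> int \<Rightarrow> int \<Rightarrow> bool" where
  "star_diagonals_nonsingular T \<epsilon> \<delta> \<sigma> \<alpha> \<beta> u n m \<longleftrightarrow>
     (\<forall>r t. diagonal_nonsingular (corner_poly T \<epsilon> \<delta> \<sigma> \<alpha> \<beta> n m r t)
              (u n m) (u (step r n) (step t m)))"

text \<open>What remains of the three-leg forms on the four quadrilaterals around a vertex with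
  value z when the legs F are eliminated; x00, x20, x02, x22 are the values at the opposite
  vertices (lower left, lower right, upper left, upper right).\<close>

definition diagonal_relation ::
  "(complex \<Rightarrow> bool) \<Rightarrow> (complex \<Rightarrow> complex \<Rightarrow> complex)
    \<Rightarrow> complex \<Rightarrow> complex \<Rightarrow> complex \<Rightarrow> complex \<Rightarrow> complex \<Rightarrow> bool" where
  "diagonal_relation mult w x00 x20 x02 x22 z \<longleftrightarrow>
     (if mult z then w z x00 * w z x22 = w z x20 * w z x02
      else w z x00 + w z x22 = w z x20 + w z x02)"

text \<open>In the Toda equations c stands for the value of chiX at (n,m).\<close>

fun toda_den :: "eqn \<Rightarrow> complex \<Rightarrow> complex \<Rightarrow> complex \<Rightarrow> complex \<Rightarrow> complex
    \<Rightarrow> complex \<Rightarrow> complex \<Rightarrow> complex \<Rightarrow> complex" where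
  "toda_den H1 \<epsilon> \<delta> \<alpha> \<beta> c x y z = (x - z) * (y - z) - \<epsilon> * c * (\<alpha> - \<beta>)^2"
| "toda_den H2 \<epsilon> \<delta> \<alpha> \<beta> c x y z =
     (x - z + (\<beta> - \<alpha>) * (1 - 2 * \<epsilon> * c * (\<alpha> + \<beta>)))
     * (y - z + (\<alpha> - \<beta>) * (1 - 2 * \<epsilon> * c * (3 * \<alpha> - \<beta>)))
     - 8 * \<epsilon> * c * (\<alpha> - \<beta>)^2 * (z + \<alpha> * (1 - 2 * \<epsilon> * \<alpha>))"
| "toda_den H3 \<epsilon> \<delta> \<alpha> \<beta> c x y z =
     \<alpha> * \<beta> * (\<alpha> * x - \<beta> * z) * (\<beta> * y - \<alpha> * z) - \<delta> * \<epsilon> * c * (\<alpha>^2 - \<beta>^2)^2"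

definition toda_H :: "eqn \<Rightarrow> complex \<Rightarrow> complex \<Rightarrow> complex \<Rightarrow> complex \<Rightarrow> complex
    \<Rightarrow> complex \<Rightarrow> complex \<Rightarrow> complex \<Rightarrow> complex" where
  "toda_H T \<epsilon> \<delta> \<alpha> \<beta> c x y z = (x - y) / toda_den T \<epsilon> \<delta> \<alpha> \<beta> c x y z"

definition toda_defined :: "eqn \<Rightarrow> complex \<Rightarrow> complex \<Rightarrow> complex \<Rightarrow> complex \<Rightarrow> complex
    \<Rightarrow> complex \<Rightarrow> complex \<Rightarrow> complex \<Rightarrow> complex \<Rightarrow> complex \<Rightarrow> bool" where
  "toda_defined T \<epsilon> \<delta> \<alpha> \<beta> c x00 x20 x02 x22 z \<longleftrightarrow>
     toda_den T \<epsilon> \<delta> \<alpha> \<beta> c x00 x20 z \<noteq> 0 \<and> toda_den T \<epsilon> \<delta> \<alpha> \<beta> c x02 x22 z \<noteq> 0"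

definition toda_eq :: "eqn \<Rightarrow> complex \<Rightarrow> complex \<Rightarrow> complex \<Rightarrow> complex \<Rightarrow> complex
    \<Rightarrow> complex \<Rightarrow> complex \<Rightarrow> complex \<Rightarrow> complex \<Rightarrow> complex \<Rightarrow> bool" where
  "toda_eq T \<epsilon> \<delta> \<alpha> \<beta> c x00 x20 x02 x22 z \<longleftrightarrow>
     toda_H T \<epsilon> \<delta> \<alpha> \<beta> c x00 x20 z - toda_H T \<epsilon> \<delta> \<alpha> \<beta> c x02 x22 z = 0"

text \<open>A relation in the values of u that enter the Toda equation at (n,m); the vertex
  (n+1,m+1) is the centre and has the colour of (n,m).\<close>

definition at_star :: "(complex \<Rightarrow> complex \<Rightarrow> complex \<Rightarrow> complex \<Rightarrow> complex \<Rightarrow> bool)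
    \<Rightarrow> (int \<Rightarrow> int \<Rightarrow> complex) \<Rightarrow> int \<Rightarrow> int \<Rightarrow> bool" where
  "at_star R u n m \<longleftrightarrow>
     R (u n m) (u (n+2) m) (u n (m+2)) (u (n+2) (m+2)) (u (n+1) (m+1))"

end

(* Seen from a distinguished vertex of colour c, all four surrounding quadrilaterals carry the same
   polynomial Q.  At a white vertex Q is, up to a factor, linear in two legs F.  At a black vertex
   with eps nonzero, affine coordinates A on the legs and m on the diagonal turn Q = 0 into
   (A3 - A2) m = theta (A2 A3 - D), with D depending on the vertex only: an addition theorem whose
   multiplicative form uses s = sqrt D and whose degenerate case D = 0 is additive, with F = 1 / A.
   Multiplying (adding) the four forms around a vertex cancels the legs, and since
   N(x) M(y) - M(x) N(y) is a multiple of x - y for affine N and M, the remaining relation between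
   the diagonals N / M is equivalent to the Toda equation. *)

theory Submission
  imports Defs
begin

section \<open>The equation seen from a distinguished vertex of given colour\<close>

text \<open>Here \<open>c\<close> is the colour of the vertex carrying \<open>w1\<close>; it
  replaces \<open>chiX\<close> as a free parameter, so that later statements need not mention a
  lattice position.\<close>

fun coloured_poly :: "eqn \<Rightarrow> complex \<Rightarrow> complex \<Rightarrow> complex
    \<Rightarrow> complex \<Rightarrow> complex \<Rightarrow> complex \<Rightarrow> complex \<Rightarrow> complex \<Rightarrow> complex \<Rightarrow> complex" where
  "coloured_poly H1 \<epsilon> \<delta> c \<alpha> \<beta> w1 w2 w3 w4 =
     (w1 - w4) * (w2 - w3) - (\<alpha> - \<beta>) + \<epsilon> * (\<alpha> - \<beta>) * (c * w2 * w3 + (1 - c) * w1 * w4)"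
| "coloured_poly H2 \<epsilon> \<delta> c \<alpha> \<beta> w1 w2 w3 w4 =
     (w1 - w4) * (w2 - w3) + (\<beta> - \<alpha>) * (w1 + w2 + w3 + w4) - \<alpha>^2 + \<beta>^2
     - \<epsilon> * (\<beta> - \<alpha>)^3
     - \<epsilon> * (\<beta> - \<alpha>) * (2 * (1 - c) * w1 + 2 * c * w2 + \<alpha> + \<beta>)
                     * (2 * (1 - c) * w4 + 2 * c * w3 + \<alpha> + \<beta>)"
| "coloured_poly H3 \<epsilon> \<delta> c \<alpha> \<beta> w1 w2 w3 w4 =
     \<alpha> * (w1 * w2 + w3 * w4) - \<beta> * (w1 * w3 + w2 * w4) + (\<alpha>^2 - \<beta>^2) * \<delta>
     - \<epsilon> * (\<alpha>^2 - \<beta>^2) / (\<alpha> * \<beta>) * (c * w2 * w3 + (1 - c) * w1 * w4)"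

lemma chiX_shift:
  "chiX \<sigma> (n - 1) m = 1 - chiX \<sigma> n m" "chiX \<sigma> n (m - 1) = 1 - chiX \<sigma> n m"
  "chiX \<sigma> (n - 1) (m - 1) = chiX \<sigma> n m" "chiX \<sigma> (n + 1) (m + 1) = chiX \<sigma> n m"
proof -
  have "n - 1 + m = (n + m) - 1" "n + (m - 1) = (n + m) - 1" "n - 1 + (m - 1) = (n + m) - 2"
    "n + 1 + (m + 1) = (n + m) + 2"
    by simp_all
  note shift = this
  have "(-1::complex) powi (k - 1) = - ((-1) powi k)" "(-1::complex) powi (k - 2) = (-1) powi k"
    "(-1::complex) powi (k + 2) = (-1) powi k" for k :: int
    by (simp_all add: power_int_diff power_int_add)
  then show "chiX \<sigma> (n - 1) m = 1 - chiX \<sigma> n m" "chiX \<sigma> n (m - 1) = 1 - chiX \<sigma> n m"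
    "chiX \<sigma> (n - 1) (m - 1) = chiX \<sigma> n m" "chiX \<sigma> (n + 1) (m + 1) = chiX \<sigma> n m"
    unfolding chiX_def shift by (simp_all only:) (simp_all add: field_simps)
qed

lemma chiY_eq: "chiY \<sigma> n m = 1 - chiX \<sigma> n m"
  by (simp add: chiX_def chiY_def field_simps)

lemma chiX_cases:
  assumes "\<sigma> = 1 \<or> \<sigma> = -1"
  shows "chiX \<sigma> n m = 0 \<or> chiX \<sigma> n m = 1"
  using assms by (auto simp: chiX_def power_int_minus_left)

text \<open>Moving to an adjacent quadrilateral exchanges \<open>chiX\<close> with
  \<open>chiY\<close>, and the reflection exchanges the pairs {w1, w4} and {w2, w3}; the two effects
  cancel. The point reflection preserves both the colour and the pairs.\<close>

lemma corner_poly_eq: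
  "corner_poly T \<epsilon> \<delta> \<sigma> \<alpha> \<beta> n m r t = coloured_poly T \<epsilon> \<delta> (chiX \<sigma> n m) \<alpha> \<beta>"
  by (intro ext, cases T; cases r; cases t) (simp_all add: chiX_shift chiY_eq algebra_simps)

text \<open>The same F and W have to give the three-leg form and the elimination of the legs, so
  both demands are bundled. The Toda half stands below the leg condition because this restricts the
  centre value: at a white vertex it excludes \<open>1 - \<epsilon> * w1^2 = 0\<close> for H1, and
  \<open>\<delta> = 0\<close> at \<open>w1 = 0\<close> for H3, where W would be constant in
  \<open>w4\<close>.\<close>

definition leg_data ::
  "eqn \<Rightarrow> complex \<Rightarrow> complex \<Rightarrow> complex \<Rightarrow> (complex \<Rightarrow> bool)
    \<Rightarrow> (complex \<Rightarrow> complex \<Rightarrow> complex \<Rightarrow> complex)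
    \<Rightarrow> (complex \<Rightarrow> complex \<Rightarrow> complex \<Rightarrow> complex \<Rightarrow> complex) \<Rightarrow> bool" where
  "leg_data T \<epsilon> \<delta> c mult F W \<longleftrightarrow>
     (finite {w. mult w} \<or> finite {w. \<not> mult w}) \<and>
     (\<forall>\<alpha> \<beta>. generic_params T \<alpha> \<beta> \<longrightarrow>
        (\<forall>w1 w2 w3. legs_nonsingular (coloured_poly T \<epsilon> \<delta> c \<alpha> \<beta>) w1 w2 w3 \<longrightarrow>
          (\<forall>w4. diagonal_nonsingular (coloured_poly T \<epsilon> \<delta> c \<alpha> \<beta>) w1 w4 \<longrightarrow>
            (if mult w1
             then F w1 w2 \<alpha> \<noteq> 0 \<and> F w1 w3 \<beta> \<noteq> 0 \<and> W \<alpha> \<beta> w1 w4 \<noteq> 0 \<and>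
                  (coloured_poly T \<epsilon> \<delta> c \<alpha> \<beta> w1 w2 w3 w4 = 0
                     \<longleftrightarrow> F w1 w2 \<alpha> / F w1 w3 \<beta> = W \<alpha> \<beta> w1 w4)
             else (coloured_poly T \<epsilon> \<delta> c \<alpha> \<beta> w1 w2 w3 w4 = 0
                     \<longleftrightarrow> F w1 w2 \<alpha> - F w1 w3 \<beta> = W \<alpha> \<beta> w1 w4))) \<and>
          (\<forall>x00 x20 x02 x22.
            (\<forall>x\<in>{x00, x20, x02, x22}. diagonal_nonsingular (coloured_poly T \<epsilon> \<delta> c \<alpha> \<beta>) w1 x) \<longrightarrow>
            toda_defined T \<epsilon> \<delta> \<alpha> \<beta> c x00 x20 x02 x22 w1 \<longrightarrow>
            (toda_eq T \<epsilon> \<delta> \<alpha> \<beta> c x00 x20 x02 x22 w1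
              \<longleftrightarrow> diagonal_relation mult (W \<alpha> \<beta>) x00 x20 x02 x22 w1))))"

section \<open>From the cross-multiplied Toda equation to relations between diagonals\<close>

lemma toda_eq_iff_cross:
  assumes "toda_defined T \<epsilon> \<delta> \<alpha> \<beta> c x00 x20 x02 x22 z"
  shows "toda_eq T \<epsilon> \<delta> \<alpha> \<beta> c x00 x20 x02 x22 z \<longleftrightarrow>
    (x00 - x20) * toda_den T \<epsilon> \<delta> \<alpha> \<beta> c x02 x22 z = (x02 - x22) * toda_den T \<epsilon> \<delta> \<alpha> \<beta> c x00 x20 z"
  using assms by (simp add: toda_eq_def toda_H_def toda_defined_def frac_eq_eq)

text \<open>The term \<open>\<mu> * (x - y)\<close> is harmless: it contributes
  \<open>\<mu> * (x - y) * (u - v)\<close> to both sides of the cross-multiplied equation. So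
  \<open>den\<close> may be replaced by the product \<open>N x * M y\<close>.\<close>

lemma cross_iff_multiplicative:
  fixes N M :: "complex \<Rightarrow> complex"
  assumes det: "\<And>x y. N x * M y - N y * M x = d * (x - y)" and "d \<noteq> 0"
    and den: "\<And>x y. s * den x y = N x * M y + \<mu> * (x - y)" and "s \<noteq> 0"
    and M: "M x \<noteq> 0" "M y \<noteq> 0" "M u \<noteq> 0" "M v \<noteq> 0"
  shows "(x - y) * den u v = (u - v) * den x y \<longleftrightarrow>
    N x / M x * (N v / M v) = N y / M y * (N u / M u)"
proof -
  have "N x / M x * (N v / M v) = N y / M y * (N u / M u) \<longleftrightarrow>
      N x * N v * (M y * M u) - N y * N u * (M x * M v) = 0"
    using M by (simp add: frac_eq_eq algebra_simps)
  \<comment> \<open>The swapped products \<open>N v * M u\<close> and \<open>N y * M x\<close> are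
    written as unswapped ones minus a determinant, ready for \<open>det\<close>.\<close>
  also have "N x * N v * (M y * M u) - N y * N u * (M x * M v) =
      (N x * M y) * (N u * M v - (N u * M v - N v * M u))
      - (N x * M y - (N x * M y - N y * M x)) * (N u * M v)"
    by (simp add: algebra_simps)
  also have "\<dots> = d * ((x - y) * (N u * M v) - (u - v) * (N x * M y))"
    unfolding det by (simp add: algebra_simps)
  also have "\<dots> = d * ((x - y) * (s * den u v) - (u - v) * (s * den x y))"
    unfolding den by (simp add: algebra_simps)
  also have "\<dots> = d * s * ((x - y) * den u v - (u - v) * den x y)"
    by (simp add: algebra_simps)
  finally show ?thesis using \<open>d \<noteq> 0\<close> \<open>s \<noteq> 0\<close> by auto
qed

text \<open>Grouped by the pairs x, y and u, v, the relation compares two differences of the form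
  \<open>N x / M x - N y / M y = d * (x - y) / (M x * M y)\<close>.\<close>

lemma cross_iff_additive:
  fixes N M :: "complex \<Rightarrow> complex"
  assumes det: "\<And>x y. N x * M y - N y * M x = d * (x - y)" and "d \<noteq> 0"
    and den: "\<And>x y. s * den x y = M x * M y + \<mu> * (x - y)" and "s \<noteq> 0"
    and M: "M x \<noteq> 0" "M y \<noteq> 0" "M u \<noteq> 0" "M v \<noteq> 0"
  shows "(x - y) * den u v = (u - v) * den x y \<longleftrightarrow>
    N x / M x + N v / M v = N y / M y + N u / M u"
proof -
  have "N x / M x + N v / M v = N y / M y + N u / M u \<longleftrightarrow>
      N x / M x - N y / M y = N u / M u - N v / M v"
    by (auto simp: algebra_simps)
  also have "\<dots> \<longleftrightarrow> (N x * M y - N y * M x) * (M u * M v) = (N u * M v - N v * M u) * (M x * M y)"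
    using M by (simp add: diff_frac_eq frac_eq_eq)
  also have "\<dots> \<longleftrightarrow> d * ((x - y) * (M u * M v) - (u - v) * (M x * M y)) = 0"
    unfolding det by (simp add: algebra_simps)
  also have "(x - y) * (M u * M v) - (u - v) * (M x * M y) =
      (x - y) * (s * den u v) - (u - v) * (s * den x y)"
    unfolding den by (simp add: algebra_simps)
  also have "\<dots> = s * ((x - y) * den u v - (u - v) * den x y)"
    by (simp add: algebra_simps)
  finally show ?thesis using \<open>d \<noteq> 0\<close> \<open>s \<noteq> 0\<close> by auto
qed

subsection \<open>White distinguished vertices\<close>

text \<open>At colour 0 the deformation touches only the product of \<open>w1\<close> and
  \<open>w4\<close>, so the equation reads (w1 - w4)(w2 - w3) = (\<alpha> - \<beta>)(1 - \<epsilon>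
  w1 w4) and each leg is the neighbouring value itself.\<close>

lemma leg_data_H1_white:
  "leg_data H1 \<epsilon> \<delta> 0 (\<lambda>_. False) (\<lambda>w1 w \<alpha>. w)
     (\<lambda>\<alpha> \<beta> w1 w4. ((\<alpha> - \<beta>) * (1 - \<epsilon> * w1 * w4)) / (w1 - w4))"
proof -
  have three_leg: "coloured_poly H1 \<epsilon> \<delta> 0 \<alpha> \<beta> w1 w2 w3 w4 = 0 \<longleftrightarrow>
      w2 - w3 = ((\<alpha> - \<beta>) * (1 - \<epsilon> * w1 * w4)) / (w1 - w4)" if "w1 \<noteq> w4" for \<alpha> \<beta> w1 w2 w3 w4
    using that by (simp add: eq_divide_eq algebra_simps)
  have diag: "diagonal_nonsingular (coloured_poly H1 \<epsilon> \<delta> 0 \<alpha> \<beta>) w1 w4 \<longleftrightarrow> w1 \<noteq> w4" for \<alpha> \<beta> w1 w4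
  proof -
    have "biquadratic (\<lambda>s t. coloured_poly H1 \<epsilon> \<delta> 0 \<alpha> \<beta> w1 s t w4) = - (w1 - w4)\<^sup>2"
      by (simp add: biquadratic_def algebra_simps power2_eq_square)
    then show ?thesis by (simp add: diagonal_nonsingular_def)
  qed
  \<comment> \<open>This value depends on \<open>w1\<close> alone and is exactly the determinant
    \<open>d\<close> needed for the additive elimination below.\<close>
  have leg: "biquadratic (\<lambda>s t. coloured_poly H1 \<epsilon> \<delta> 0 \<alpha> \<beta> w1 w2 s t) = (\<alpha> - \<beta>) * (1 - \<epsilon> * w1\<^sup>2)"
    for \<alpha> \<beta> w1 w2
    by (simp add: biquadratic_def algebra_simps power2_eq_square)
  have toda: "toda_eq H1 \<epsilon> \<delta> \<alpha> \<beta> 0 x y u v z \<longleftrightarrow>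
      diagonal_relation (\<lambda>_. False) (\<lambda>w1 w4. ((\<alpha> - \<beta>) * (1 - \<epsilon> * w1 * w4)) / (w1 - w4)) x y u v z"
    if "(\<alpha> - \<beta>) * (1 - \<epsilon> * z\<^sup>2) \<noteq> 0" "z \<noteq> x" "z \<noteq> y" "z \<noteq> u" "z \<noteq> v"
      "toda_defined H1 \<epsilon> \<delta> \<alpha> \<beta> 0 x y u v z" for \<alpha> \<beta> x y u v z
    unfolding diagonal_relation_def toda_eq_iff_cross[OF that(6)] if_False
    by (rule cross_iff_additive[where d = "(\<alpha> - \<beta>) * (1 - \<epsilon> * z\<^sup>2)" and s = 1 and \<mu> = 0])
      (use that in \<open>auto simp: algebra_simps power2_eq_square\<close>)
  show ?thesis
    unfolding leg_data_def legs_nonsingular_def diag leg using three_leg toda by simp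
qed

text \<open>F and W can be read off the biquadratics: up to constants, that of a leg is F, and that
  of the diagonal is the numerator of W times its denominator. Nonsingularity thus says that F and W
  have neither zeros nor poles.\<close>

lemma leg_data_H2_white:
  "leg_data H2 \<epsilon> \<delta> 0 (\<lambda>_. True) (\<lambda>w1 w \<alpha>. w1 + w + \<alpha> - 2 * \<epsilon> * (w1 + \<alpha>)\<^sup>2)
     (\<lambda>\<alpha> \<beta> w1 w4. (w4 - w1 + (\<beta> - \<alpha>)) / (w4 - w1 - (\<beta> - \<alpha>)))"
proof -
  define F where "F = (\<lambda>w1 w \<alpha>. w1 + w + \<alpha> - 2 * \<epsilon> * (w1 + \<alpha>)\<^sup>2)"
  have Q: "coloured_poly H2 \<epsilon> \<delta> 0 \<alpha> \<beta> w1 w2 w3 w4 =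
      (w4 - w1 + (\<beta> - \<alpha>)) * F w1 w3 \<beta> - (w4 - w1 - (\<beta> - \<alpha>)) * F w1 w2 \<alpha>" for \<alpha> \<beta> w1 w2 w3 w4
    unfolding F_def by (simp add: algebra_simps power2_eq_square power3_eq_cube)
  have three_leg: "coloured_poly H2 \<epsilon> \<delta> 0 \<alpha> \<beta> w1 w2 w3 w4 = 0 \<longleftrightarrow>
      F w1 w2 \<alpha> / F w1 w3 \<beta> = (w4 - w1 + (\<beta> - \<alpha>)) / (w4 - w1 - (\<beta> - \<alpha>))"
    if "F w1 w3 \<beta> \<noteq> 0" "w4 - w1 - (\<beta> - \<alpha>) \<noteq> 0" for \<alpha> \<beta> w1 w2 w3 w4
    unfolding Q using that by (auto simp: frac_eq_eq mult.commute)
  have diag: "biquadratic (\<lambda>s t. coloured_poly H2 \<epsilon> \<delta> 0 \<alpha> \<beta> w1 s t w4) =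
      - (w4 - w1 + (\<beta> - \<alpha>)) * (w4 - w1 - (\<beta> - \<alpha>))" for \<alpha> \<beta> w1 w4
    by (simp add: biquadratic_def) algebra
  have leg2: "biquadratic (\<lambda>s t. coloured_poly H2 \<epsilon> \<delta> 0 \<alpha> \<beta> w1 w2 s t) = 2 * (\<alpha> - \<beta>) * F w1 w2 \<alpha>"
    for \<alpha> \<beta> w1 w2
    by (simp add: biquadratic_def F_def) algebra
  have leg3: "biquadratic (\<lambda>s t. coloured_poly H2 \<epsilon> \<delta> 0 \<alpha> \<beta> w1 s w3 t) = 2 * (\<beta> - \<alpha>) * F w1 w3 \<beta>"
    for \<alpha> \<beta> w1 w3
    by (simp add: biquadratic_def F_def) algebra
  have toda: "toda_eq H2 \<epsilon> \<delta> \<alpha> \<beta> 0 x y u v z \<longleftrightarrow>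
      diagonal_relation (\<lambda>_. True) (\<lambda>w1 w4. (w4 - w1 + (\<beta> - \<alpha>)) / (w4 - w1 - (\<beta> - \<alpha>))) x y u v z"
    if "\<alpha> \<noteq> \<beta>" "\<forall>w\<in>{x, y, u, v}. w - z - (\<beta> - \<alpha>) \<noteq> 0"
      "toda_defined H2 \<epsilon> \<delta> \<alpha> \<beta> 0 x y u v z" for \<alpha> \<beta> x y u v z
    unfolding diagonal_relation_def toda_eq_iff_cross[OF that(3)] if_True
    \<comment> \<open>At colour 0 \<open>toda_den\<close> is exactly the numerator of W at x times
      its denominator at y.\<close>
    by (rule cross_iff_multiplicative[where d = "2 * (\<alpha> - \<beta>)" and s = 1 and \<mu> = 0])
      (use that in \<open>auto simp: algebra_simps power2_eq_square\<close>)
  show ?thesis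
    unfolding leg_data_def legs_nonsingular_def diagonal_nonsingular_def diag leg2 leg3
      F_def[symmetric]
  proof (intro conjI allI impI, goal_cases)
    case (2 \<alpha> \<beta> w1 w2 w3 w4)
    then have "F w1 w2 \<alpha> \<noteq> 0" "F w1 w3 \<beta> \<noteq> 0" "w4 - w1 + (\<beta> - \<alpha>) \<noteq> 0" "w4 - w1 - (\<beta> - \<alpha>) \<noteq> 0"
      unfolding mult_eq_0_iff neg_equal_0_iff_equal by simp_all
    then show ?case using three_leg by simp
  next
    case (3 \<alpha> \<beta> z w2 w3 x y u v)
    then have "\<alpha> \<noteq> \<beta>" "\<forall>w\<in>{x, y, u, v}. w - z - (\<beta> - \<alpha>) \<noteq> 0"
      unfolding mult_eq_0_iff neg_equal_0_iff_equal by simp_all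
    then show ?case using toda 3 by blast
  qed simp
qed

text \<open>After multiplication by \<open>w1\<close> the equation splits into two legs as for H2.
  At \<open>w1 = 0\<close> the zero and the pole of W merge; there the equation has lost its
  \<open>w1\<close> terms and is additive after division by \<alpha> \<beta> w4.\<close>

lemma leg_data_H3_white:
  "leg_data H3 \<epsilon> \<delta> 0 (\<lambda>w. w \<noteq> 0)
     (\<lambda>w1 w \<alpha>. if w1 = 0 then w / \<alpha> else w1 * w + \<alpha> * \<delta> - \<epsilon> * w1\<^sup>2 / \<alpha>)
     (\<lambda>\<alpha> \<beta> w1 w4. if w1 = 0 then ((\<alpha>\<^sup>2 - \<beta>\<^sup>2) * \<delta> / (\<alpha> * \<beta>)) / w4
                     else (\<alpha> * w4 - \<beta> * w1) / (\<beta> * w4 - \<alpha> * w1))"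
proof -
  define F where "F = (\<lambda>w1 w \<alpha>. w1 * w + \<alpha> * \<delta> - \<epsilon> * w1\<^sup>2 / \<alpha>)"
  have Q: "w1 * coloured_poly H3 \<epsilon> \<delta> 0 \<alpha> \<beta> w1 w2 w3 w4 =
      (\<alpha> * w4 - \<beta> * w1) * F w1 w3 \<beta> - (\<beta> * w4 - \<alpha> * w1) * F w1 w2 \<alpha>"
    if "\<alpha> \<noteq> 0" "\<beta> \<noteq> 0" for \<alpha> \<beta> w1 w2 w3 w4
    using that unfolding F_def by (simp add: field_simps power2_eq_square)
  have three_leg: "coloured_poly H3 \<epsilon> \<delta> 0 \<alpha> \<beta> w1 w2 w3 w4 = 0 \<longleftrightarrow>
      F w1 w2 \<alpha> / F w1 w3 \<beta> = (\<alpha> * w4 - \<beta> * w1) / (\<beta> * w4 - \<alpha> * w1)"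
    if "\<alpha> \<noteq> 0" "\<beta> \<noteq> 0" "w1 \<noteq> 0" "F w1 w3 \<beta> \<noteq> 0" "\<beta> * w4 - \<alpha> * w1 \<noteq> 0" for \<alpha> \<beta> w1 w2 w3 w4
  proof -
    have "coloured_poly H3 \<epsilon> \<delta> 0 \<alpha> \<beta> w1 w2 w3 w4 = 0 \<longleftrightarrow>
        w1 * coloured_poly H3 \<epsilon> \<delta> 0 \<alpha> \<beta> w1 w2 w3 w4 = 0"
      using that by (simp only: mult_eq_0_iff) simp
    also have "\<dots> \<longleftrightarrow> F w1 w2 \<alpha> / F w1 w3 \<beta> = (\<alpha> * w4 - \<beta> * w1) / (\<beta> * w4 - \<alpha> * w1)"
      unfolding Q[OF that(1,2)] using that by (auto simp: frac_eq_eq mult.commute)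
    finally show ?thesis .
  qed
  have three_leg_0: "coloured_poly H3 \<epsilon> \<delta> 0 \<alpha> \<beta> 0 w2 w3 w4 = 0 \<longleftrightarrow>
      w2 / \<alpha> - w3 / \<beta> = ((\<alpha>\<^sup>2 - \<beta>\<^sup>2) * \<delta> / (\<alpha> * \<beta>)) / w4"
    if "\<alpha> \<noteq> 0" "\<beta> \<noteq> 0" "w4 \<noteq> 0" for \<alpha> \<beta> w2 w3 w4
  proof -
    have "w2 / \<alpha> = \<beta> * w2 * w4 / (\<alpha> * \<beta> * w4)" "w3 / \<beta> = \<alpha> * w3 * w4 / (\<alpha> * \<beta> * w4)"
      using that by simp_all
    then have "w2 / \<alpha> - w3 / \<beta> - ((\<alpha>\<^sup>2 - \<beta>\<^sup>2) * \<delta> / (\<alpha> * \<beta>)) / w4 =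
        (\<beta> * w2 * w4 - \<alpha> * w3 * w4 - (\<alpha>\<^sup>2 - \<beta>\<^sup>2) * \<delta>) / (\<alpha> * \<beta> * w4)"
      by (simp only: diff_divide_distrib divide_divide_eq_left)
    also have "\<beta> * w2 * w4 - \<alpha> * w3 * w4 - (\<alpha>\<^sup>2 - \<beta>\<^sup>2) * \<delta> = - coloured_poly H3 \<epsilon> \<delta> 0 \<alpha> \<beta> 0 w2 w3 w4"
      by (simp add: algebra_simps)
    finally show ?thesis using that by (metis divide_eq_0_iff eq_iff_diff_eq_0 mult_eq_0_iff neg_equal_0_iff_equal)
  qed
  have diag: "biquadratic (\<lambda>s t. coloured_poly H3 \<epsilon> \<delta> 0 \<alpha> \<beta> w1 s t w4) =
      - (\<alpha> * w4 - \<beta> * w1) * (\<beta> * w4 - \<alpha> * w1)" if "\<alpha> \<noteq> 0" "\<beta> \<noteq> 0" for \<alpha> \<beta> w1 w4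
    using that by (simp add: biquadratic_def field_simps power2_eq_square)
  have leg2: "biquadratic (\<lambda>s t. coloured_poly H3 \<epsilon> \<delta> 0 \<alpha> \<beta> w1 w2 s t) = (\<beta>\<^sup>2 - \<alpha>\<^sup>2) * F w1 w2 \<alpha>"
    if "\<alpha> \<noteq> 0" "\<beta> \<noteq> 0" for \<alpha> \<beta> w1 w2
    using that by (simp add: biquadratic_def F_def field_simps power2_eq_square)
  have leg3: "biquadratic (\<lambda>s t. coloured_poly H3 \<epsilon> \<delta> 0 \<alpha> \<beta> w1 s w3 t) = (\<alpha>\<^sup>2 - \<beta>\<^sup>2) * F w1 w3 \<beta>"
    if "\<alpha> \<noteq> 0" "\<beta> \<noteq> 0" for \<alpha> \<beta> w1 w3
    using that by (simp add: biquadratic_def F_def field_simps power2_eq_square)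
  let ?W = "\<lambda>\<alpha> \<beta> w1 w4. if w1 = 0 then ((\<alpha>\<^sup>2 - \<beta>\<^sup>2) * \<delta> / (\<alpha> * \<beta>)) / w4
                     else (\<alpha> * w4 - \<beta> * w1) / (\<beta> * w4 - \<alpha> * w1)"
  have toda: "toda_eq H3 \<epsilon> \<delta> \<alpha> \<beta> 0 x y u v z \<longleftrightarrow> diagonal_relation (\<lambda>w. w \<noteq> 0) (?W \<alpha> \<beta>) x y u v z"
    if "generic_params H3 \<alpha> \<beta>" "F z w \<alpha> \<noteq> 0" "\<forall>w\<in>{x, y, u, v}. \<beta> * w - \<alpha> * z \<noteq> 0"
      "toda_defined H3 \<epsilon> \<delta> \<alpha> \<beta> 0 x y u v z" for \<alpha> \<beta> x y u v z w
  proof (cases "z = 0")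
    case True
    \<comment> \<open>At z = 0 the leg F is \<alpha> \<delta>, so its nonvanishing gives \<delta>
      \<noteq> 0, which makes the determinant \<open>d\<close> nonzero.\<close>
    have "(x - y) * toda_den H3 \<epsilon> \<delta> \<alpha> \<beta> 0 u v 0 = (u - v) * toda_den H3 \<epsilon> \<delta> \<alpha> \<beta> 0 x y 0 \<longleftrightarrow>
        ((\<alpha>\<^sup>2 - \<beta>\<^sup>2) * \<delta> / (\<alpha> * \<beta>)) / x + ((\<alpha>\<^sup>2 - \<beta>\<^sup>2) * \<delta> / (\<alpha> * \<beta>)) / v =
        ((\<alpha>\<^sup>2 - \<beta>\<^sup>2) * \<delta> / (\<alpha> * \<beta>)) / y + ((\<alpha>\<^sup>2 - \<beta>\<^sup>2) * \<delta> / (\<alpha> * \<beta>)) / u"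
      by (rule cross_iff_additive[where d = "- ((\<alpha>\<^sup>2 - \<beta>\<^sup>2) * \<delta> / (\<alpha> * \<beta>))"
            and s = "1 / (\<alpha>\<^sup>2 * \<beta>\<^sup>2)" and \<mu> = 0])
        (use that True in \<open>auto simp: field_simps power2_eq_square F_def\<close>)
    then show ?thesis
      unfolding diagonal_relation_def toda_eq_iff_cross[OF that(4)] using True by simp
  next
    case False
    have "(x - y) * toda_den H3 \<epsilon> \<delta> \<alpha> \<beta> 0 u v z = (u - v) * toda_den H3 \<epsilon> \<delta> \<alpha> \<beta> 0 x y z \<longleftrightarrow>
        (\<alpha> * x - \<beta> * z) / (\<beta> * x - \<alpha> * z) * ((\<alpha> * v - \<beta> * z) / (\<beta> * v - \<alpha> * z)) =
        (\<alpha> * y - \<beta> * z) / (\<beta> * y - \<alpha> * z) * ((\<alpha> * u - \<beta> * z) / (\<beta> * u - \<alpha> * z))"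
      \<comment> \<open>This determinant carries the factor z, which is why z = 0 needs the additive
        form.\<close>
      by (rule cross_iff_multiplicative[where d = "(\<beta>\<^sup>2 - \<alpha>\<^sup>2) * z"
            and s = "1 / (\<alpha> * \<beta>)" and \<mu> = 0])
        (use that False in \<open>auto simp: field_simps power2_eq_square\<close>)
    then show ?thesis
      unfolding diagonal_relation_def toda_eq_iff_cross[OF that(4)] using False by simp
  qed
  have fin: "finite {w::complex. \<not> w \<noteq> 0}" by simp
  show ?thesis
    unfolding leg_data_def
  proof (intro conjI allI impI, goal_cases)
    case 1
    show ?case using fin by simp
  next
    case (2 \<alpha> \<beta> w1 w2 w3 w4)
    then have nz: "\<alpha> \<noteq> 0" "\<beta> \<noteq> 0" by auto
    have "F w1 w2 \<alpha> \<noteq> 0" "F w1 w3 \<beta> \<noteq> 0" "\<alpha> * w4 - \<beta> * w1 \<noteq> 0" "\<beta> * w4 - \<alpha> * w1 \<noteq> 0"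
      using 2 unfolding legs_nonsingular_def diagonal_nonsingular_def diag[OF nz] leg2[OF nz] leg3[OF nz]
      by auto
    then show ?case
      using three_leg[OF nz, of w1 w3 w4 w2] three_leg_0[OF nz, of w4 w2 w3] nz
      by (cases "w1 = 0") (simp_all add: F_def del: coloured_poly.simps)
  next
    case (3 \<alpha> \<beta> w1 w2 w3 x y u v)
    then have nz: "\<alpha> \<noteq> 0" "\<beta> \<noteq> 0" by auto
    have "F w1 w2 \<alpha> \<noteq> 0" "\<forall>w\<in>{x, y, u, v}. \<beta> * w - \<alpha> * w1 \<noteq> 0"
      using 3 unfolding legs_nonsingular_def diagonal_nonsingular_def diag[OF nz] leg2[OF nz] by auto
    then show ?case using toda 3 by blast
  qed
qed

lemma leg_data_white: "\<exists>mult F W. leg_data T \<epsilon> \<delta> 0 mult F W"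
  using leg_data_H1_white leg_data_H2_white leg_data_H3_white by (cases T) blast+

subsection \<open>Black distinguished vertices\<close>

text \<open>The coordinates come from completing the square: the biquadratics of leg and diagonal
  become multiples of A^2 - D and m^2 - \<theta>^2 D.\<close>

fun leg_coord :: "eqn \<Rightarrow> complex \<Rightarrow> complex \<Rightarrow> complex \<Rightarrow> complex \<Rightarrow> complex" where
  "leg_coord H1 \<epsilon> w1 w \<alpha> = \<epsilon> * w"
| "leg_coord H2 \<epsilon> w1 w \<alpha> = 4 * \<epsilon> * (w + \<alpha>) - 1"
| "leg_coord H3 \<epsilon> w1 w \<alpha> = 2 * \<epsilon> * w / \<alpha> - w1"

fun diag_coord :: "eqn \<Rightarrow> complex \<Rightarrow> complex \<Rightarrow> complex \<Rightarrow> complex \<Rightarrow> complex \<Rightarrow> complex" where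
  "diag_coord H1 \<epsilon> \<alpha> \<beta> w1 w = w - w1"
| "diag_coord H2 \<epsilon> \<alpha> \<beta> w1 w = w - w1 - 2 * \<epsilon> * (\<beta> - \<alpha>)\<^sup>2"
| "diag_coord H3 \<epsilon> \<alpha> \<beta> w1 w = 2 * \<alpha> * \<beta> * w - (\<alpha>\<^sup>2 + \<beta>\<^sup>2) * w1"

fun diag_scale :: "eqn \<Rightarrow> complex \<Rightarrow> complex \<Rightarrow> complex" where
  "diag_scale H1 \<alpha> \<beta> = \<beta> - \<alpha>"
| "diag_scale H2 \<alpha> \<beta> = \<beta> - \<alpha>"
| "diag_scale H3 \<alpha> \<beta> = \<alpha>\<^sup>2 - \<beta>\<^sup>2"

text \<open>For \<epsilon> \<noteq> 0 and generic parameters its zeros are the values of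
  \<open>w1\<close> at which the leg biquadratic has a double root in the outer value.\<close>

fun discr :: "eqn \<Rightarrow> complex \<Rightarrow> complex \<Rightarrow> complex \<Rightarrow> complex" where
  "discr H1 \<epsilon> \<delta> w1 = \<epsilon>"
| "discr H2 \<epsilon> \<delta> w1 = 1 + 8 * \<epsilon> * w1"
| "discr H3 \<epsilon> \<delta> w1 = w1\<^sup>2 + 4 * \<epsilon> * \<delta>"

lemma diag_scale_nonzero: "generic_params T \<alpha> \<beta> \<Longrightarrow> diag_scale T \<alpha> \<beta> \<noteq> 0"
  by (cases T) auto

text \<open>With leg coordinates A2, A3 and diagonal coordinate m the equation becomes
  (A3 - A2) m = \<theta> (A2 A3 - D), where the discriminant D depends on the distinguished vertex
  only.  For D = s^2 this is the addition theorem that turns products of (A + s) / (A - s)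
  into (m + \<theta> s) / (m - \<theta> s).\<close>

lemma coloured_poly_black:
  assumes "generic_params T \<alpha> \<beta>" "\<epsilon> \<noteq> 0"
  shows "\<exists>\<nu>. \<nu> \<noteq> 0 \<and> \<nu> * coloured_poly T \<epsilon> \<delta> 1 \<alpha> \<beta> w1 w2 w3 w4 =
     (leg_coord T \<epsilon> w1 w3 \<beta> - leg_coord T \<epsilon> w1 w2 \<alpha>) * diag_coord T \<epsilon> \<alpha> \<beta> w1 w4
     - diag_scale T \<alpha> \<beta> * (leg_coord T \<epsilon> w1 w2 \<alpha> * leg_coord T \<epsilon> w1 w3 \<beta> - discr T \<epsilon> \<delta> w1)"
proof (cases T)
  case H1
  show ?thesis
    by (rule exI[of _ \<epsilon>]) (use assms H1 in \<open>simp add: algebra_simps power2_eq_square\<close>)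
next
  case H2
  show ?thesis
    by (rule exI[of _ "4 * \<epsilon>"])
      (use assms H2 in \<open>simp add: algebra_simps power2_eq_square power3_eq_cube\<close>)
next
  case H3
  show ?thesis
    by (rule exI[of _ "4 * \<epsilon>"]) (use assms H3 in \<open>simp add: field_simps power2_eq_square\<close>)
qed

text \<open>What matters is the consequence A^2 \<noteq> D for nonsingular legs: with s^2 = D,
  neither A - s nor A + s vanishes.\<close>

lemma leg_biquadratic_black:
  assumes "generic_params T \<alpha> \<beta>" "\<epsilon> \<noteq> 0"
  shows "\<exists>\<nu> \<kappa>. \<nu> \<noteq> 0 \<and> \<nu> * biquadratic (\<lambda>s t. coloured_poly T \<epsilon> \<delta> 1 \<alpha> \<beta> w1 w2 s t) =
      \<kappa> * ((leg_coord T \<epsilon> w1 w2 \<alpha>)\<^sup>2 - discr T \<epsilon> \<delta> w1)" (is ?A)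
    and "\<exists>\<nu> \<kappa>. \<nu> \<noteq> 0 \<and> \<nu> * biquadratic (\<lambda>s t. coloured_poly T \<epsilon> \<delta> 1 \<alpha> \<beta> w1 s w3 t) =
      \<kappa> * ((leg_coord T \<epsilon> w1 w3 \<beta>)\<^sup>2 - discr T \<epsilon> \<delta> w1)" (is ?B)
proof -
  have "?A \<and> ?B"
  proof (cases T)
    case H1
    show ?thesis
      by (intro conjI; rule exI[of _ \<epsilon>])
        (rule exI[of _ "\<beta> - \<alpha>"] exI[of _ "\<alpha> - \<beta>"],
          use assms H1 in \<open>simp add: biquadratic_def algebra_simps power2_eq_square\<close>)+
  next
    case H2
    have "4 * \<epsilon> * biquadratic (\<lambda>s t. coloured_poly T \<epsilon> \<delta> 1 \<alpha> \<beta> w1 w2 s t) =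
        (\<beta> - \<alpha>) * ((leg_coord T \<epsilon> w1 w2 \<alpha>)\<^sup>2 - discr T \<epsilon> \<delta> w1)"
      "4 * \<epsilon> * biquadratic (\<lambda>s t. coloured_poly T \<epsilon> \<delta> 1 \<alpha> \<beta> w1 s w3 t) =
        (\<alpha> - \<beta>) * ((leg_coord T \<epsilon> w1 w3 \<beta>)\<^sup>2 - discr T \<epsilon> \<delta> w1)"
      unfolding H2 biquadratic_def coloured_poly.simps leg_coord.simps discr.simps by algebra+
    then show ?thesis using assms(2) by (metis mult_eq_0_iff zero_neq_numeral)
  next
    case H3
    then have nz: "\<alpha> \<noteq> 0" "\<beta> \<noteq> 0" using assms(1) by auto
    have "4 * \<epsilon> * biquadratic (\<lambda>s t. coloured_poly T \<epsilon> \<delta> 1 \<alpha> \<beta> w1 w2 s t) =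
        (\<alpha>\<^sup>2 - \<beta>\<^sup>2) * \<alpha> * ((leg_coord T \<epsilon> w1 w2 \<alpha>)\<^sup>2 - discr T \<epsilon> \<delta> w1)"
      "4 * \<epsilon> * biquadratic (\<lambda>s t. coloured_poly T \<epsilon> \<delta> 1 \<alpha> \<beta> w1 s w3 t) =
        (\<beta>\<^sup>2 - \<alpha>\<^sup>2) * \<beta> * ((leg_coord T \<epsilon> w1 w3 \<beta>)\<^sup>2 - discr T \<epsilon> \<delta> w1)"
      using nz by (simp_all add: H3 biquadratic_def field_simps power2_eq_square)
    then show ?thesis using assms(2) by (metis mult_eq_0_iff zero_neq_numeral)
  qed
  then show ?A ?B by auto
qed

lemma diag_biquadratic_black:
  assumes "generic_params T \<alpha> \<beta>"
  shows "\<exists>\<kappa>. biquadratic (\<lambda>s t. coloured_poly T \<epsilon> \<delta> 1 \<alpha> \<beta> w1 s t w4) =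
      \<kappa> * ((diag_coord T \<epsilon> \<alpha> \<beta> w1 w4)\<^sup>2 - (diag_scale T \<alpha> \<beta>)\<^sup>2 * discr T \<epsilon> \<delta> w1)"
proof (cases T)
  case H1
  show ?thesis
    by (rule exI[of _ "-1"]) (use H1 in \<open>simp add: biquadratic_def algebra_simps power2_eq_square\<close>)
next
  case H2
  show ?thesis
    by (rule exI[of _ "-1"])
      (unfold H2 biquadratic_def coloured_poly.simps diag_coord.simps diag_scale.simps discr.simps,
        algebra)
next
  case H3
  show ?thesis
    by (rule exI[of _ "- 1 / (4 * \<alpha> * \<beta>)"])
      (use assms H3 in \<open>simp add: biquadratic_def field_simps power2_eq_square\<close>)
qed

text \<open>For H2 and H3 the denominator is not symmetric in x and y;
  \<open>\<mu> * (x - y)\<close> is the antisymmetric part of its multiple by \<open>s\<close>, and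
  it drops out on cross-multiplication. The values of \<open>\<mu>\<close> follow from comparing
  coefficients of x.\<close>

lemma toda_den_black:
  "\<exists>s \<mu>. s \<noteq> 0 \<and> (\<forall>x y. s * toda_den T \<epsilon> \<delta> \<alpha> \<beta> 1 x y z =
     diag_coord T \<epsilon> \<alpha> \<beta> z x * diag_coord T \<epsilon> \<alpha> \<beta> z y - (diag_scale T \<alpha> \<beta>)\<^sup>2 * discr T \<epsilon> \<delta> z
     + \<mu> * (x - y))"
proof (cases T)
  case H1
  show ?thesis
    by (rule exI[of _ 1], rule exI[of _ 0])
      (use H1 in \<open>simp add: algebra_simps power2_eq_square\<close>)
next
  case H2
  show ?thesis
    by (rule exI[of _ 1], rule exI[of _ "(\<alpha> - \<beta>) * (1 - 2 * \<epsilon> * (3 * \<alpha> - \<beta>)) + 2 * \<epsilon> * (\<beta> - \<alpha>)\<^sup>2"])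
      (use H2 in \<open>simp add: algebra_simps power2_eq_square\<close>)
next
  case H3
  show ?thesis
    by (rule exI[of _ 4], rule exI[of _ "2 * \<alpha> * \<beta> * (\<beta>\<^sup>2 - \<alpha>\<^sup>2) * z"])
      (use H3 in \<open>simp add: algebra_simps power2_eq_square\<close>)
qed

lemma diag_coord_diff:
  assumes "generic_params T \<alpha> \<beta>"
  shows "\<exists>k. k \<noteq> 0 \<and> (\<forall>x y. diag_coord T \<epsilon> \<alpha> \<beta> z x - diag_coord T \<epsilon> \<alpha> \<beta> z y = k * (x - y))"
proof (cases "T = H3")
  case True
  then show ?thesis using assms by (intro exI[of _ "2 * \<alpha> * \<beta>"]) (simp add: algebra_simps)
next
  case False
  then show ?thesis by (intro exI[of _ 1], cases T) simp_all
qed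

text \<open>The zeros of D are the exceptional values at which the form is additive; for \<epsilon>
  \<noteq> 0, D is a nonzero polynomial of degree at most two in w.\<close>

lemma finite_discr_zero:
  assumes "\<epsilon> \<noteq> 0"
  shows "finite {w. \<not> discr T \<epsilon> \<delta> w \<noteq> 0}"
proof (cases T)
  case H1
  then show ?thesis using assms by simp
next
  case H2
  have "w = - 1 / (8 * \<epsilon>)" if "1 + 8 * \<epsilon> * w = 0" for w
    using that assms by (simp add: field_simps add_eq_0_iff)
  then have "{w. \<not> discr T \<epsilon> \<delta> w \<noteq> 0} \<subseteq> {- 1 / (8 * \<epsilon>)}"
    using H2 by auto
  then show ?thesis by (rule finite_subset) simp
next
  case H3
  have "w\<^sup>2 = (csqrt (- 4 * \<epsilon> * \<delta>))\<^sup>2" if "w\<^sup>2 + 4 * \<epsilon> * \<delta> = 0" for w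
    using that by (simp add: add_eq_0_iff2)
  then have "{w. \<not> discr T \<epsilon> \<delta> w \<noteq> 0} \<subseteq> {csqrt (- 4 * \<epsilon> * \<delta>), - csqrt (- 4 * \<epsilon> * \<delta>)}"
    unfolding power2_eq_iff using H3 by auto
  then show ?thesis by (rule finite_subset) simp
qed

text \<open>This is the addition formula of coth: for A2 = s coth a and A3 = s coth b the quotients
  on the left are exp(2a) and exp(2b), and the right-hand equation says m = \<theta> s coth(a -
  b).\<close>

lemma quotient_addition_iff:
  fixes s :: complex
  assumes "A2 \<noteq> s" "A3 \<noteq> s" "A3 \<noteq> - s" "m - \<theta> * s \<noteq> 0" "s \<noteq> 0"
  shows "(A2 + s) / (A2 - s) / ((A3 + s) / (A3 - s)) = (m + \<theta> * s) / (m - \<theta> * s) \<longleftrightarrow>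
    (A3 - A2) * m - \<theta> * (A2 * A3 - s\<^sup>2) = 0"
proof -
  have nz: "A2 - s \<noteq> 0" "A3 - s \<noteq> 0" "A3 + s \<noteq> 0"
    using assms by (auto simp: add_eq_0_iff2)
  have "(A2 + s) / (A2 - s) / ((A3 + s) / (A3 - s)) = (m + \<theta> * s) / (m - \<theta> * s) \<longleftrightarrow>
    (A2 + s) * (A3 - s) * (m - \<theta> * s) - (m + \<theta> * s) * ((A2 - s) * (A3 + s)) = 0"
    using nz assms(4) by (simp add: frac_eq_eq)
  \<comment> \<open>The factor 2 s shows why D = 0 is treated apart: there the multiplicative form
    reads 1 = 1.\<close>
  also have "(A2 + s) * (A3 - s) * (m - \<theta> * s) - (m + \<theta> * s) * ((A2 - s) * (A3 + s)) =
    2 * s * ((A3 - A2) * m - \<theta> * (A2 * A3 - s\<^sup>2))"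
    by (simp add: algebra_simps power2_eq_square)
  finally show ?thesis using assms(5) by simp
qed

text \<open>The branch of the square root does not matter: replacing s by -s inverts F and W
  together. For D = 0 the equation (A3 - A2) m = \<theta> A2 A3 becomes additive on division by A2
  A3 m.\<close>

lemma leg_data_black:
  assumes "\<epsilon> \<noteq> 0"
  shows "leg_data T \<epsilon> \<delta> 1 (\<lambda>w. discr T \<epsilon> \<delta> w \<noteq> 0)
    (\<lambda>w1 w \<alpha>. if discr T \<epsilon> \<delta> w1 = 0 then 1 / leg_coord T \<epsilon> w1 w \<alpha>
       else (leg_coord T \<epsilon> w1 w \<alpha> + csqrt (discr T \<epsilon> \<delta> w1))
            / (leg_coord T \<epsilon> w1 w \<alpha> - csqrt (discr T \<epsilon> \<delta> w1)))
    (\<lambda>\<alpha> \<beta> w1 w. if discr T \<epsilon> \<delta> w1 = 0 then diag_scale T \<alpha> \<beta> / diag_coord T \<epsilon> \<alpha> \<beta> w1 w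
       else (diag_coord T \<epsilon> \<alpha> \<beta> w1 w + diag_scale T \<alpha> \<beta> * csqrt (discr T \<epsilon> \<delta> w1))
            / (diag_coord T \<epsilon> \<alpha> \<beta> w1 w - diag_scale T \<alpha> \<beta> * csqrt (discr T \<epsilon> \<delta> w1)))"
    (is "leg_data _ _ _ _ ?mult ?F ?W")
  unfolding leg_data_def
proof (intro conjI allI impI, goal_cases)
  case 1
  show ?case using finite_discr_zero[OF assms] by blast
next
  case (2 \<alpha> \<beta> w1 w2 w3 w4)
  define A2 A3 m \<theta> D s where defs: "A2 = leg_coord T \<epsilon> w1 w2 \<alpha>" "A3 = leg_coord T \<epsilon> w1 w3 \<beta>"
    "m = diag_coord T \<epsilon> \<alpha> \<beta> w1 w4" "\<theta> = diag_scale T \<alpha> \<beta>" "D = discr T \<epsilon> \<delta> w1" "s = csqrt D"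
  have s2: "s\<^sup>2 = D" and s0: "s = 0 \<longleftrightarrow> D = 0" by (simp_all add: defs)
  obtain \<nu> where \<nu>: "\<nu> \<noteq> 0" "\<nu> * coloured_poly T \<epsilon> \<delta> 1 \<alpha> \<beta> w1 w2 w3 w4 = (A3 - A2) * m - \<theta> * (A2 * A3 - s\<^sup>2)"
    using coloured_poly_black[OF 2(1) assms] unfolding s2 unfolding defs by blast
  then have Q: "coloured_poly T \<epsilon> \<delta> 1 \<alpha> \<beta> w1 w2 w3 w4 = 0 \<longleftrightarrow> (A3 - A2) * m - \<theta> * (A2 * A3 - s\<^sup>2) = 0"
    by (metis mult_eq_0_iff)
  \<comment> \<open>The nonsingularity assumptions in the completed-square coordinates.\<close>
  have ns: "A2\<^sup>2 \<noteq> s\<^sup>2" "A3\<^sup>2 \<noteq> s\<^sup>2" "m\<^sup>2 \<noteq> (\<theta> * s)\<^sup>2"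
    using 2(2,3) leg_biquadratic_black[OF 2(1) assms] diag_biquadratic_black[OF 2(1)]
    unfolding s2 power_mult_distrib unfolding defs legs_nonsingular_def diagonal_nonsingular_def
    by (metis eq_iff_diff_eq_0 mult_eq_0_iff)+
  then have nz: "A2 \<noteq> s" "A2 + s \<noteq> 0" "A3 \<noteq> s" "A3 + s \<noteq> 0" "m - \<theta> * s \<noteq> 0" "m + \<theta> * s \<noteq> 0"
    by (auto simp: power2_eq_iff add_eq_0_iff2)
  show ?case
  proof (cases "D = 0")
    case True
    have "1 / A2 - 1 / A3 = \<theta> / m \<longleftrightarrow> (A3 - A2) * m - \<theta> * (A2 * A3 - s\<^sup>2) = 0"
      using nz True s0 by (simp add: field_simps)
    then show ?thesis using True Q unfolding defs by simp
  next
    case False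
    have "(A2 + s) / (A2 - s) / ((A3 + s) / (A3 - s)) = (m + \<theta> * s) / (m - \<theta> * s) \<longleftrightarrow>
        (A3 - A2) * m - \<theta> * (A2 * A3 - s\<^sup>2) = 0"
      by (rule quotient_addition_iff) (use nz s0 False in \<open>auto simp: add_eq_0_iff2\<close>)
    then show ?thesis using False Q nz unfolding defs by simp
  qed
next
  case (3 \<alpha> \<beta> z w2 w3 x y u v)
  define m \<theta> D s where defs: "m = diag_coord T \<epsilon> \<alpha> \<beta> z" "\<theta> = diag_scale T \<alpha> \<beta>"
    "D = discr T \<epsilon> \<delta> z" "s = csqrt D"
  have s2: "s\<^sup>2 = D" and s0: "s = 0 \<longleftrightarrow> D = 0" by (simp_all add: defs)
  have "(m w)\<^sup>2 \<noteq> (\<theta> * s)\<^sup>2" if "w \<in> {x, y, u, v}" for w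
    using 3(3) that diag_biquadratic_black[OF 3(1)]
    unfolding s2 power_mult_distrib unfolding defs diagonal_nonsingular_def
    by (metis eq_iff_diff_eq_0 mult_eq_0_iff)
  then have nz: "m w - \<theta> * s \<noteq> 0" if "w \<in> {x, y, u, v}" for w
    using that by (auto simp: power2_eq_iff)
  have \<theta>0: "\<theta> \<noteq> 0" using diag_scale_nonzero[OF 3(1)] by (simp add: defs)
  obtain a \<mu> where a: "a \<noteq> 0"
    "\<And>x y. a * toda_den T \<epsilon> \<delta> \<alpha> \<beta> 1 x y z = m x * m y - \<theta>\<^sup>2 * s\<^sup>2 + \<mu> * (x - y)"
    using toda_den_black[of T \<epsilon> \<delta> \<alpha> \<beta> z] unfolding s2 unfolding defs by blast
  obtain k where k: "k \<noteq> 0" "\<And>x y. m x - m y = k * (x - y)"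
    using diag_coord_diff[OF 3(1)] unfolding defs by blast
  show ?case
  proof (cases "D = 0")
    case True
    have "(x - y) * toda_den T \<epsilon> \<delta> \<alpha> \<beta> 1 u v z = (u - v) * toda_den T \<epsilon> \<delta> \<alpha> \<beta> 1 x y z \<longleftrightarrow>
        \<theta> / m x + \<theta> / m v = \<theta> / m y + \<theta> / m u"
      by (rule cross_iff_additive[where d = "- \<theta> * k" and s = a and \<mu> = \<mu>])
        (use nz s0 True a k \<theta>0 in \<open>simp_all add: right_diff_distrib[symmetric] del: right_diff_distrib, simp_all add: algebra_simps\<close>)
    then show ?thesis
      unfolding diagonal_relation_def toda_eq_iff_cross[OF 3(4)] using True by (simp add: defs)
  next
    case False
    have "(m x + \<theta> * s) * (m y - \<theta> * s) - (m y + \<theta> * s) * (m x - \<theta> * s) = - 2 * \<theta> * s * (m x - m y)"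
      for x y by (simp add: algebra_simps)
    then have det: "(m x + \<theta> * s) * (m y - \<theta> * s) - (m y + \<theta> * s) * (m x - \<theta> * s) = - 2 * \<theta> * s * k * (x - y)"
      for x y by (simp add: k(2))
    have "(m x + \<theta> * s) * (m y - \<theta> * s) = m x * m y - \<theta>\<^sup>2 * s\<^sup>2 - \<theta> * s * (m x - m y)" for x y
      by (simp add: algebra_simps power2_eq_square)
    note prod = this[unfolded k(2)]
    \<comment> \<open>Turning the symmetric product of the m's into numerator times denominator
      costs a multiple of x - y, which is added to \<open>\<mu>\<close>.\<close>
    have den: "a * toda_den T \<epsilon> \<delta> \<alpha> \<beta> 1 x y z =
        (m x + \<theta> * s) * (m y - \<theta> * s) + (\<mu> + \<theta> * s * k) * (x - y)" for x y
      unfolding a(2) prod by (simp add: algebra_simps)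
    have "(x - y) * toda_den T \<epsilon> \<delta> \<alpha> \<beta> 1 u v z = (u - v) * toda_den T \<epsilon> \<delta> \<alpha> \<beta> 1 x y z \<longleftrightarrow>
        (m x + \<theta> * s) / (m x - \<theta> * s) * ((m v + \<theta> * s) / (m v - \<theta> * s)) =
        (m y + \<theta> * s) / (m y - \<theta> * s) * ((m u + \<theta> * s) / (m u - \<theta> * s))"
      by (rule cross_iff_multiplicative[OF det _ den]) (use nz s0 False a(1) k(1) \<theta>0 in auto)
    then show ?thesis
      unfolding diagonal_relation_def toda_eq_iff_cross[OF 3(4)] using False by (simp add: defs)
  qed
qed

section \<open>The undeformed case and existence of the leg data\<close>

lemma coloured_poly_undeformed: "coloured_poly T 0 \<delta> c = coloured_poly T 0 \<delta> c'"
  by (intro ext, cases T) simp_all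

lemma toda_den_undeformed: "toda_den T 0 \<delta> \<alpha> \<beta> c x y z = toda_den T 0 \<delta> \<alpha> \<beta> c' x y z"
  by (cases T) simp_all

text \<open>For \<epsilon> = 0 the black leg coordinates are constant in the outer value and carry
  no information, but then the equation no longer sees the colour and the white forms apply.\<close>

lemma leg_data_exists:
  assumes "c \<in> {0, 1}"
  shows "\<exists>mult F W. leg_data T \<epsilon> \<delta> c mult F W"
proof (cases "c = 0 \<or> \<epsilon> = 0")
  case True
  have "leg_data T 0 \<delta> 1 = leg_data T 0 \<delta> 0"
    unfolding leg_data_def toda_defined_def toda_eq_def toda_H_def
      coloured_poly_undeformed[of T \<delta> 1 0] toda_den_undeformed[of T \<delta> _ _ 1 _ _ _ 0] ..
  then show ?thesis using leg_data_white True assms by auto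
next
  case False
  then show ?thesis using leg_data_black assms by blast
qed

subsection \<open>The Toda equations\<close>

lemma three_leg_form_of_leg_data:
  assumes "leg_data T \<epsilon> \<delta> c mult F W"
  shows "three_leg_form T \<epsilon> \<delta> \<sigma> c mult F W"
  using assms unfolding three_leg_form_def leg_data_def corner_poly_eq by blast

lemma toda_iff_diagonal_relation:
  assumes "leg_data T \<epsilon> \<delta> c mult F W" "generic_params T \<alpha> \<beta>" "chiX \<sigma> n m = c"
    and "star_legs_nonsingular T \<epsilon> \<delta> \<sigma> \<alpha> \<beta> u (n+1) (m+1)"
    and diags: "star_diagonals_nonsingular T \<epsilon> \<delta> \<sigma> \<alpha> \<beta> u (n+1) (m+1)"
    and "at_star (toda_defined T \<epsilon> \<delta> \<alpha> \<beta> c) u n m"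
  shows "at_star (toda_eq T \<epsilon> \<delta> \<alpha> \<beta> c) u n m \<longleftrightarrow> at_star (diagonal_relation mult (W \<alpha> \<beta>)) u n m"
proof -
  let ?ns = "diagonal_nonsingular (coloured_poly T \<epsilon> \<delta> c \<alpha> \<beta>) (u (n+1) (m+1))"
  have "?ns (u (step r (n+1)) (step t (m+1)))" for r t
    using diags assms(3) unfolding star_diagonals_nonsingular_def corner_poly_eq chiX_shift by simp
  \<comment> \<open>The order is lower left, lower right, upper left, upper right, since
    \<open>step\<close> is taken from the centre.\<close>
  from this[of False False] this[of True False] this[of False True] this[of True True]
  have "\<forall>x\<in>{u n m, u (n+2) m, u n (m+2), u (n+2) (m+2)}. ?ns x"
    by (simp add: step_def add.assoc)
  moreover have "legs_nonsingular (coloured_poly T \<epsilon> \<delta> c \<alpha> \<beta>) (u (n+1) (m+1))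
      (u (step True (n+1)) (m+1)) (u (n+1) (step True (m+1)))"
    using assms(3,4) unfolding star_legs_nonsingular_def corner_poly_eq chiX_shift by simp
  ultimately show ?thesis
    using assms(1,2,6) unfolding leg_data_def at_star_def by blast
qed

section \<open>Affine linearity and factorisation of the biquadratics\<close>

lemma coloured_poly_affine:
  fixes T :: eqn and \<epsilon> \<delta> c \<alpha> \<beta> :: complex
  defines "Q \<equiv> coloured_poly T \<epsilon> \<delta> c \<alpha> \<beta>"
  shows "Q w1 w2 w3 w4 = Q w1 0 w3 w4 + w2 * (Q w1 1 w3 w4 - Q w1 0 w3 w4)"
    and "Q w1 w2 w3 w4 = Q w1 w2 0 w4 + w3 * (Q w1 w2 1 w4 - Q w1 w2 0 w4)"
    and "Q w1 w2 w3 w4 = Q w1 w2 w3 0 + w4 * (Q w1 w2 w3 1 - Q w1 w2 w3 0)"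
  unfolding Q_def
  by (cases T; simp add: algebra_simps add_divide_distrib diff_divide_distrib)+

text \<open>For f = a + b s + c t + d s t both sides equal b c - a d. The base point is left free so
  that it can be placed on a zero of f, where only the product of the two partial derivatives
  survives.\<close>

lemma biquadratic_affine:
  assumes "\<And>s t. f s t = f 0 t + s * (f 1 t - f 0 t)" "\<And>s t. f s t = f s 0 + t * (f s 1 - f s 0)"
  shows "biquadratic f = (f 1 t - f 0 t) * (f s 1 - f s 0) - f s t * (f 1 1 - f 1 0 - f 0 1 + f 0 0)"
proof -
  have "f 0 t = f 0 0 + t * (f 0 1 - f 0 0)" "f 1 t = f 1 0 + t * (f 1 1 - f 1 0)"
    "f s 0 = f 0 0 + s * (f 1 0 - f 0 0)" "f s 1 = f 0 1 + s * (f 1 1 - f 0 1)"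
    "f s t = f 0 t + s * (f 1 t - f 0 t)"
    using assms by blast+
  then show ?thesis unfolding biquadratic_def by algebra
qed

text \<open>On Q = 0 the biquadratics factorise: h12 = Q3 Q4, h13 = Q2 Q4 and h14 = Q2 Q3 (subscripts
  on Q denoting partial derivatives), so the diagonal is nonsingular when both legs are.\<close>

lemma diagonal_nonsingular_of_legs:
  assumes "legs_nonsingular (coloured_poly T \<epsilon> \<delta> c \<alpha> \<beta>) w1 w2 w3"
    and "coloured_poly T \<epsilon> \<delta> c \<alpha> \<beta> w1 w2 w3 w4 = 0"
  shows "diagonal_nonsingular (coloured_poly T \<epsilon> \<delta> c \<alpha> \<beta>) w1 w4"
proof -
  define Q where "Q = coloured_poly T \<epsilon> \<delta> c \<alpha> \<beta>"
  have Q0: "Q w1 w2 w3 w4 = 0" using assms(2) by (simp add: Q_def)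
  note affine = coloured_poly_affine[where T = T and \<epsilon> = \<epsilon> and \<delta> = \<delta> and c = c and \<alpha> = \<alpha> and \<beta> = \<beta>,
      folded Q_def]
  have "biquadratic (\<lambda>s t. Q w1 w2 s t) =
      (Q w1 w2 1 w4 - Q w1 w2 0 w4) * (Q w1 w2 w3 1 - Q w1 w2 w3 0)"
    using biquadratic_affine[of "\<lambda>s t. Q w1 w2 s t" w4 w3, OF affine(2,3)] Q0 by simp
  moreover have "biquadratic (\<lambda>s t. Q w1 s w3 t) =
      (Q w1 1 w3 w4 - Q w1 0 w3 w4) * (Q w1 w2 w3 1 - Q w1 w2 w3 0)"
    using biquadratic_affine[of "\<lambda>s t. Q w1 s w3 t" w4 w2, OF affine(1,3)] Q0 by simp
  moreover have "biquadratic (\<lambda>s t. Q w1 s t w4) =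
      (Q w1 1 w3 w4 - Q w1 0 w3 w4) * (Q w1 w2 1 w4 - Q w1 w2 0 w4)"
    using biquadratic_affine[of "\<lambda>s t. Q w1 s t w4" w3 w2, OF affine(1,2)] Q0 by simp
  ultimately show ?thesis
    using assms(1) unfolding legs_nonsingular_def diagonal_nonsingular_def Q_def[symmetric] by simp
qed

section \<open>Elimination of the legs around a vertex\<close>

lemma leg_data_three_leg:
  assumes "leg_data T \<epsilon> \<delta> c mult F W" "generic_params T \<alpha> \<beta>"
    and "legs_nonsingular (coloured_poly T \<epsilon> \<delta> c \<alpha> \<beta>) w1 w2 w3"
    and "diagonal_nonsingular (coloured_poly T \<epsilon> \<delta> c \<alpha> \<beta>) w1 w4"
  shows "if mult w1
    then F w1 w2 \<alpha> \<noteq> 0 \<and> F w1 w3 \<beta> \<noteq> 0 \<and> W \<alpha> \<beta> w1 w4 \<noteq> 0 \<and>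
      (coloured_poly T \<epsilon> \<delta> c \<alpha> \<beta> w1 w2 w3 w4 = 0 \<longleftrightarrow> F w1 w2 \<alpha> / F w1 w3 \<beta> = W \<alpha> \<beta> w1 w4)
    else (coloured_poly T \<epsilon> \<delta> c \<alpha> \<beta> w1 w2 w3 w4 = 0 \<longleftrightarrow> F w1 w2 \<alpha> - F w1 w3 \<beta> = W \<alpha> \<beta> w1 w4)"
  using assms unfolding leg_data_def by blast

text \<open>Here r, l are the \<alpha>-neighbours and a, b the \<beta>-neighbours of the centre.
  Opposite quadrilaterals together use each of the four legs once, so both sides of the relation are
  the same expression in the legs.\<close>

lemma three_leg_star_elimination:
  assumes eqn: "leg_data T \<epsilon> \<delta> c mult F W" "generic_params T \<alpha> \<beta>"
    and legs: "legs_nonsingular (coloured_poly T \<epsilon> \<delta> c \<alpha> \<beta>) z r a" "legs_nonsingular (coloured_poly T \<epsilon> \<delta> c \<alpha> \<beta>) z l a"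
      "legs_nonsingular (coloured_poly T \<epsilon> \<delta> c \<alpha> \<beta>) z r b" "legs_nonsingular (coloured_poly T \<epsilon> \<delta> c \<alpha> \<beta>) z l b"
    and Q: "coloured_poly T \<epsilon> \<delta> c \<alpha> \<beta> z r a x22 = 0" "coloured_poly T \<epsilon> \<delta> c \<alpha> \<beta> z l a x02 = 0"
      "coloured_poly T \<epsilon> \<delta> c \<alpha> \<beta> z r b x20 = 0" "coloured_poly T \<epsilon> \<delta> c \<alpha> \<beta> z l b x00 = 0"
  shows "diagonal_relation mult (W \<alpha> \<beta>) x00 x20 x02 x22 z"
proof -
  have *: "if mult z then F z p \<alpha> / F z q \<beta> = W \<alpha> \<beta> z x else F z p \<alpha> - F z q \<beta> = W \<alpha> \<beta> z x"
    if "legs_nonsingular (coloured_poly T \<epsilon> \<delta> c \<alpha> \<beta>) z p q" "coloured_poly T \<epsilon> \<delta> c \<alpha> \<beta> z p q x = 0" for p q x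
    using leg_data_three_leg[OF eqn that(1) diagonal_nonsingular_of_legs[OF that]] that(2) by presburger
  note rel = *[OF legs(1) Q(1)] *[OF legs(2) Q(2)] *[OF legs(3) Q(3)] *[OF legs(4) Q(4)]
  show ?thesis
  proof (cases "mult z")
    case True
    with rel have "W \<alpha> \<beta> z x22 = F z r \<alpha> / F z a \<beta>" "W \<alpha> \<beta> z x02 = F z l \<alpha> / F z a \<beta>"
      "W \<alpha> \<beta> z x20 = F z r \<alpha> / F z b \<beta>" "W \<alpha> \<beta> z x00 = F z l \<alpha> / F z b \<beta>"
      by simp_all
    with True show ?thesis by (simp add: diagonal_relation_def)
  next
    case False
    with rel have "W \<alpha> \<beta> z x22 = F z r \<alpha> - F z a \<beta>" "W \<alpha> \<beta> z x02 = F z l \<alpha> - F z a \<beta>"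
      "W \<alpha> \<beta> z x20 = F z r \<alpha> - F z b \<beta>" "W \<alpha> \<beta> z x00 = F z l \<alpha> - F z b \<beta>"
      by simp_all
    with False show ?thesis by (simp add: diagonal_relation_def)
  qed
qed

lemma solution_corner:
  assumes "solution T \<epsilon> \<delta> \<sigma> \<alpha> \<beta> u"
  shows "corner_poly T \<epsilon> \<delta> \<sigma> \<alpha> \<beta> n m r t (u n m) (u (step r n) m) (u n (step t m)) (u (step r n) (step t m)) = 0"
proof -
  have "quad_poly T \<epsilon> \<delta> \<sigma> \<alpha> \<beta> n m (u n m) (u (n+1) m) (u n (m+1)) (u (n+1) (m+1)) = 0" for n m
    using assms by (simp add: solution_def)
  from this[of n m] this[of "n-1" m] this[of n "m-1"] this[of "n-1" "m-1"]
  show ?thesis by (cases r; cases t) (simp_all add: step_def)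
qed

lemma solution_toda:
  assumes \<sigma>: "\<sigma> = 1 \<or> \<sigma> = -1" and gen: "generic_params T \<alpha> \<beta>" and sol: "solution T \<epsilon> \<delta> \<sigma> \<alpha> \<beta> u"
    and legs: "star_legs_nonsingular T \<epsilon> \<delta> \<sigma> \<alpha> \<beta> u (n+1) (m+1)"
    and def: "at_star (toda_defined T \<epsilon> \<delta> \<alpha> \<beta> (chiX \<sigma> n m)) u n m"
  shows "at_star (toda_eq T \<epsilon> \<delta> \<alpha> \<beta> (chiX \<sigma> n m)) u n m"
proof -
  define c where "c = chiX \<sigma> n m"
  have "c \<in> {0, 1}" using chiX_cases[OF \<sigma>] by (auto simp: c_def)
  then obtain mult F W where data: "leg_data T \<epsilon> \<delta> c mult F W"
    using leg_data_exists by blast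
  note corner = solution_corner[OF sol, of "n+1" "m+1", unfolded corner_poly_eq chiX_shift, folded c_def]
  note leg = legs[unfolded star_legs_nonsingular_def corner_poly_eq chiX_shift, folded c_def, rule_format]
  \<comment> \<open>On a solution the diagonals inherit nonsingularity from the legs.\<close>
  have diags: "star_diagonals_nonsingular T \<epsilon> \<delta> \<sigma> \<alpha> \<beta> u (n+1) (m+1)"
    unfolding star_diagonals_nonsingular_def corner_poly_eq chiX_shift c_def[symmetric]
    using diagonal_nonsingular_of_legs[OF leg corner] by blast
  have "diagonal_relation mult (W \<alpha> \<beta>)
      (u (step False (n+1)) (step False (m+1))) (u (step True (n+1)) (step False (m+1)))
      (u (step False (n+1)) (step True (m+1))) (u (step True (n+1)) (step True (m+1))) (u (n+1) (m+1))"
    by (rule three_leg_star_elimination[OF data gen leg leg leg leg corner corner corner corner])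
  then have "at_star (diagonal_relation mult (W \<alpha> \<beta>)) u n m"
    by (simp add: at_star_def step_def add.assoc)
  then show ?thesis
    using toda_iff_diagonal_relation[OF data gen c_def[symmetric] legs diags] def by (simp add: c_def)
qed

text \<open>The cleared Toda equation is symmetric in y and u because the denominators are affine
  linear in each of their first two arguments.\<close>

lemma toda_swap:
  assumes "toda_defined T \<epsilon> \<delta> \<alpha> \<beta> c x y u v z" "toda_defined T \<epsilon> \<delta> \<alpha> \<beta> c x u y v z"
  shows "toda_eq T \<epsilon> \<delta> \<alpha> \<beta> c x y u v z \<longleftrightarrow> toda_eq T \<epsilon> \<delta> \<alpha> \<beta> c x u y v z"
proof -
  have "(x - y) * toda_den T \<epsilon> \<delta> \<alpha> \<beta> c u v z - (u - v) * toda_den T \<epsilon> \<delta> \<alpha> \<beta> c x y z =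
      (x - u) * toda_den T \<epsilon> \<delta> \<alpha> \<beta> c y v z - (y - v) * toda_den T \<epsilon> \<delta> \<alpha> \<beta> c x u z"
    by (cases T) (simp_all add: algebra_simps)
  then show ?thesis
    unfolding toda_eq_iff_cross[OF assms(1)] toda_eq_iff_cross[OF assms(2)]
    by (metis eq_iff_diff_eq_0)
qed

section \<open>The two colours give different Toda equations\<close>

text \<open>At colour 0 the equation says 1/y - 1/x = 1/v - 1/u, which holds for s, s/2, s/2, s/3.
  At colour 1 the extra \<open>e\<close> would then force x - y = u - v, that is s/2 = s/6.\<close>

lemma toda_colours_differ_product:
  fixes k e :: complex
  assumes k: "k \<noteq> 0" and e: "e \<noteq> 0"
    and den: "\<And>c x y. toda_den T \<epsilon> \<delta> \<alpha> \<beta> c x y 0 = k * x * y - c * e"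
  shows "\<exists>x y u v z. toda_defined T \<epsilon> \<delta> \<alpha> \<beta> 0 x y u v z \<and> toda_defined T \<epsilon> \<delta> \<alpha> \<beta> 1 x y u v z \<and>
    (toda_eq T \<epsilon> \<delta> \<alpha> \<beta> 0 x y u v z \<longleftrightarrow> \<not> toda_eq T \<epsilon> \<delta> \<alpha> \<beta> 1 x y u v z)"
proof -
  \<comment> \<open>The number p is to be the square of x; the excluded values are the zeros of the
    denominators for the two colours.\<close>
  have "finite {0, 2 * e / k, 6 * e / k}" by simp
  from ex_new_if_finite[OF infinite_UNIV_char_0 this]
  obtain p where p: "p \<noteq> 0" "p \<noteq> 2 * e / k" "p \<noteq> 6 * e / k" by auto
  define s where "s = csqrt p"
  have ss: "s * s = p" and s0: "s \<noteq> 0" using p(1) by (simp_all add: s_def flip: power2_eq_square)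
  have den': "toda_den T \<epsilon> \<delta> \<alpha> \<beta> c s (s / 2) 0 = k * p / 2 - c * e"
    "toda_den T \<epsilon> \<delta> \<alpha> \<beta> c (s / 2) (s / 3) 0 = k * p / 6 - c * e" for c
    by (simp_all add: den ss[symmetric])
  have defd: "toda_defined T \<epsilon> \<delta> \<alpha> \<beta> 0 s (s / 2) (s / 2) (s / 3) 0"
    "toda_defined T \<epsilon> \<delta> \<alpha> \<beta> 1 s (s / 2) (s / 2) (s / 3) 0"
    using p k by (auto simp: toda_defined_def den' field_simps)
  have "toda_eq T \<epsilon> \<delta> \<alpha> \<beta> 0 s (s / 2) (s / 2) (s / 3) 0"
    by (simp add: toda_eq_iff_cross[OF defd(1)] den' field_simps)
  moreover have "\<not> toda_eq T \<epsilon> \<delta> \<alpha> \<beta> 1 s (s / 2) (s / 2) (s / 3) 0"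
    using s0 e by (simp add: toda_eq_iff_cross[OF defd(2)] den' field_simps)
  ultimately show ?thesis using defd by blast
qed

lemma toda_colours_differ:
  assumes "generic_params T \<alpha> \<beta>" "\<epsilon> \<noteq> 0" "T = H3 \<longrightarrow> \<delta> \<noteq> 0"
  shows "\<exists>x y u v z. toda_defined T \<epsilon> \<delta> \<alpha> \<beta> 0 x y u v z \<and> toda_defined T \<epsilon> \<delta> \<alpha> \<beta> 1 x y u v z \<and>
    (toda_eq T \<epsilon> \<delta> \<alpha> \<beta> 0 x y u v z \<longleftrightarrow> \<not> toda_eq T \<epsilon> \<delta> \<alpha> \<beta> 1 x y u v z)"
proof (cases T)
  case H1
  have "toda_den H1 \<epsilon> \<delta> \<alpha> \<beta> c x y 0 = 1 * x * y - c * (\<epsilon> * (\<alpha> - \<beta>)\<^sup>2)" for c x y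
    by simp
  then show ?thesis
    unfolding H1 by (rule toda_colours_differ_product[rotated 2]) (use assms H1 in auto)
next
  case H2
  define b where "b = \<beta> - \<alpha>"
  have b: "b \<noteq> 0" "\<alpha> - \<beta> = - b" using assms(1) H2 by (auto simp: b_def)
  define f where "f = 8 * \<epsilon> * b\<^sup>2"
  have f: "f \<noteq> 0" using assms(2) b by (simp add: f_def)
  define P where "P = (\<lambda>x y. (x + b * (1 - 2 * \<epsilon> * (\<alpha> + \<beta>))) * (y - b * (1 - 2 * \<epsilon> * (3 * \<alpha> - \<beta>))))"
  have den0: "toda_den H2 \<epsilon> \<delta> \<alpha> \<beta> 0 x y z = (x - z + b) * (y - z - b)" for x y z
    by (simp add: b_def algebra_simps)
  have den1: "toda_den H2 \<epsilon> \<delta> \<alpha> \<beta> 1 x y z =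
      P (x - z) (y - z) - f * (z + \<alpha> * (1 - 2 * \<epsilon> * \<alpha>))" for x y z
    by (simp add: b(2) f_def P_def flip: b_def)
  \<comment> \<open>For z + 2b, z, z, z - 2b both numerators equal 2b, so the Toda equation compares
    denominators. They agree at colour 0, both being -3 b^2, and differ by this amount at colour
    1.\<close>
  have P: "P 0 (- 2 * b) - P (2 * b) 0 = 8 * \<epsilon> * b ^ 3"
    unfolding P_def b_def by (simp add: algebra_simps power3_eq_cube)
  \<comment> \<open>As f \<noteq> 0, each colour 1 denominator is affine in z with a single zero,
    and z has to avoid both.\<close>
  have "finite {P (2 * b) 0 / f - \<alpha> * (1 - 2 * \<epsilon> * \<alpha>), P 0 (- 2 * b) / f - \<alpha> * (1 - 2 * \<epsilon> * \<alpha>)}" by simp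
  from ex_new_if_finite[OF infinite_UNIV_char_0 this]
  obtain z where "z \<noteq> P (2 * b) 0 / f - \<alpha> * (1 - 2 * \<epsilon> * \<alpha>)" "z \<noteq> P 0 (- 2 * b) / f - \<alpha> * (1 - 2 * \<epsilon> * \<alpha>)"
    by auto
  then have z: "P (2 * b) 0 - f * (z + \<alpha> * (1 - 2 * \<epsilon> * \<alpha>)) \<noteq> 0" "P 0 (- 2 * b) - f * (z + \<alpha> * (1 - 2 * \<epsilon> * \<alpha>)) \<noteq> 0"
    using f by (auto simp: eq_diff_eq eq_divide_eq mult.commute)
  have defd: "toda_defined H2 \<epsilon> \<delta> \<alpha> \<beta> 0 (z + 2 * b) z z (z - 2 * b) z"
    "toda_defined H2 \<epsilon> \<delta> \<alpha> \<beta> 1 (z + 2 * b) z z (z - 2 * b) z"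
    using z b by (simp_all add: toda_defined_def den0 den1 del: toda_den.simps)
  have "toda_eq H2 \<epsilon> \<delta> \<alpha> \<beta> 0 (z + 2 * b) z z (z - 2 * b) z"
    by (simp add: toda_eq_iff_cross[OF defd(1)] den0 del: toda_den.simps)
  moreover have "\<not> toda_eq H2 \<epsilon> \<delta> \<alpha> \<beta> 1 (z + 2 * b) z z (z - 2 * b) z"
    using P b assms(2) by (auto simp: toda_eq_iff_cross[OF defd(2)] den1 simp del: toda_den.simps)
  ultimately show ?thesis using defd H2 by blast
next
  case H3
  have "toda_den H3 \<epsilon> \<delta> \<alpha> \<beta> c x y 0 = (\<alpha>\<^sup>2 * \<beta>\<^sup>2) * x * y - c * (\<delta> * \<epsilon> * (\<alpha>\<^sup>2 - \<beta>\<^sup>2)\<^sup>2)" for c x y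
    by (simp add: power2_eq_square)
  then show ?thesis
    unfolding H3 by (rule toda_colours_differ_product[rotated 2]) (use assms H3 in auto)
qed

theorem mainTheorem6:
  fixes T :: eqn and \<epsilon> \<delta> \<sigma> :: complex
  assumes "\<sigma> = 1 \<or> \<sigma> = -1"
  shows
    "(\<forall>c\<in>{0, 1}. \<exists>mult F W.
        three_leg_form T \<epsilon> \<delta> \<sigma> c mult F W \<and>
        (\<forall>\<alpha> \<beta> u n m.
           generic_params T \<alpha> \<beta> \<longrightarrow> chiX \<sigma> n m = c \<longrightarrow>
           star_legs_nonsingular T \<epsilon> \<delta> \<sigma> \<alpha> \<beta> u (n+1) (m+1) \<longrightarrow>
           star_diagonals_nonsingular T \<epsilon> \<delta> \<sigma> \<alpha> \<beta> u (n+1) (m+1) \<longrightarrow>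
           at_star (toda_defined T \<epsilon> \<delta> \<alpha> \<beta> c) u n m \<longrightarrow>
           (at_star (toda_eq T \<epsilon> \<delta> \<alpha> \<beta> c) u n m
              \<longleftrightarrow> at_star (diagonal_relation mult (W \<alpha> \<beta>)) u n m)))
     \<and>
     (\<forall>\<alpha> \<beta> u n m.
        generic_params T \<alpha> \<beta> \<longrightarrow> solution T \<epsilon> \<delta> \<sigma> \<alpha> \<beta> u \<longrightarrow>
        star_legs_nonsingular T \<epsilon> \<delta> \<sigma> \<alpha> \<beta> u (n+1) (m+1) \<longrightarrow>
        at_star (toda_defined T \<epsilon> \<delta> \<alpha> \<beta> (chiX \<sigma> n m)) u n m \<longrightarrow>
        at_star (toda_eq T \<epsilon> \<delta> \<alpha> \<beta> (chiX \<sigma> n m)) u n m)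
     \<and>
     (\<forall>\<alpha> \<beta>. \<forall>c\<in>{0, 1}. \<forall>x00 x20 x02 x22 z.
        generic_params T \<alpha> \<beta> \<longrightarrow>
        toda_defined T \<epsilon> \<delta> \<alpha> \<beta> c x00 x20 x02 x22 z \<longrightarrow>
        toda_defined T \<epsilon> \<delta> \<alpha> \<beta> c x00 x02 x20 x22 z \<longrightarrow>
        (toda_eq T \<epsilon> \<delta> \<alpha> \<beta> c x00 x20 x02 x22 z \<longleftrightarrow> toda_eq T \<epsilon> \<delta> \<alpha> \<beta> c x00 x02 x20 x22 z))
     \<and>
     (\<forall>\<alpha> \<beta>. generic_params T \<alpha> \<beta> \<longrightarrow> \<epsilon> \<noteq> 0 \<longrightarrow> (T = H3 \<longrightarrow> \<delta> \<noteq> 0) \<longrightarrow>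
        (\<exists>x00 x20 x02 x22 z.
           toda_defined T \<epsilon> \<delta> \<alpha> \<beta> 0 x00 x20 x02 x22 z \<and>
           toda_defined T \<epsilon> \<delta> \<alpha> \<beta> 1 x00 x20 x02 x22 z \<and>
           (toda_eq T \<epsilon> \<delta> \<alpha> \<beta> 0 x00 x20 x02 x22 z
              \<longleftrightarrow> \<not> toda_eq T \<epsilon> \<delta> \<alpha> \<beta> 1 x00 x20 x02 x22 z)))"
proof (intro conjI, goal_cases)
  case 1
  show ?case
  proof
    fix c :: complex
    assume "c \<in> {0, 1}"
    then obtain mult F W where "leg_data T \<epsilon> \<delta> c mult F W"
      using leg_data_exists by blast
    from three_leg_form_of_leg_data[OF this] toda_iff_diagonal_relation[OF this]
    show "\<exists>mult F W. three_leg_form T \<epsilon> \<delta> \<sigma> c mult F W \<and>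
        (\<forall>\<alpha> \<beta> u n m.
           generic_params T \<alpha> \<beta> \<longrightarrow> chiX \<sigma> n m = c \<longrightarrow>
           star_legs_nonsingular T \<epsilon> \<delta> \<sigma> \<alpha> \<beta> u (n+1) (m+1) \<longrightarrow>
           star_diagonals_nonsingular T \<epsilon> \<delta> \<sigma> \<alpha> \<beta> u (n+1) (m+1) \<longrightarrow>
           at_star (toda_defined T \<epsilon> \<delta> \<alpha> \<beta> c) u n m \<longrightarrow>
           (at_star (toda_eq T \<epsilon> \<delta> \<alpha> \<beta> c) u n m
              \<longleftrightarrow> at_star (diagonal_relation mult (W \<alpha> \<beta>)) u n m))"
      by blast
  qed
next
  case 2
  show ?case using solution_toda[OF assms] by blast
next
  case 3
  show ?case using toda_swap by blast
next
  case 4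
  show ?case using toda_colours_differ by blast
qed

end
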